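(* Let $R$ be a commutative ring with $asr(R)=1$. Then the following properties hold: (1) The ring $R$ is an $SE_2^{\triangle}$ ring, i.e., each upper (or lower) triangular matrix in $Um(\mathbb{M}_2(R))$ is simply extendable. (2) (McGovern) If $R$ is a Hermite ring, then $R$ is an elementary divisor ring (EDR).
   Context: Rings are commutative with identity; $J(R)$ is the Jacobson radical. $Um(R^n)$ is the set of $n$-tuples generating the unit ideal; $Um(\mathbb{M}_2(R))$ is the set of $2\times2$ matrices whose entries generate the unit ideal. $A\in\mathbb{M}_2(R)$ is simply extendable if there is $A^+\in SL_3(R)$ whose upper-left $2\times2$ block is $A$ and whose $(3,3)$ entry is $0$. A ring $S$ has stable range 1, $sr(S)=1$, if for each $(a,b)\in Um(S^2)$ there is $r\in S$ with $a+br$ a unit. $R$ has almost stable range 1, written $asr(R)=1$, if for each ideal $I$ of $R$ not contained in $J(R)$, $sr(R/I)=1$. An $m\times n$ matrix over $R$ admits diagonal reduction if it is equivalent (via multiplication on the left and right by invertible matrices) to a matrix whose off-diagonal entries are $0$ and whose diagonal entries $a_{1,1},\ldots,a_{s,s}$, $s=\min\{m,n\}$, satisfy $a_{i,i}\mid a_{i+1,i+1}$ for all $i\in\{1,\ldots,s-1\}$. $R$ is a Hermite ring (in the sense of Kaplansky) if each $1\times 2$ matrix with entries in $R$ admits diagonal reduction, equivalently, for each $(p,q)\in R^2$ there exist $r\in R$ and $(s,t)\in Um(R^2)$ with $p=rs$, $q=rt$. $R$ is an elementary divisor ring (EDR) if for all $m,n\ge 1$ each $m\times n$ matrix with entries in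 $R$ admits diagonal reduction. *)

theory Defs
  imports "HOL-Algebra.QuotRing" "HOL-Algebra.Divisibility"
    "HOL-Combinatorics.Permutations" "Jordan_Normal_Form.Matrix"
begin

text \<open>Rings are carrier-based (HOL-Algebra), so that the zero ring and the quotients
  \<open>R Quot I\<close> are covered uniformly.  The matrix type \<open>'a mat\<close> is only used as a container
  (dimensions and 0-based entries); its library arithmetic belongs to type-class rings,
  so product, identity and determinant are defined here with respect to \<open>R\<close>.\<close>

definition jacobson_radical :: "('a, 'b) ring_scheme \<Rightarrow> 'a set" where
  "jacobson_radical R = {x \<in> carrier R. \<forall>M. maximalideal M R \<longrightarrow> x \<in> M}"

definition Um :: "('a, 'b) ring_scheme \<Rightarrow> nat \<Rightarrow> 'a list set" where
  "Um R n = {xs. length xs = n \<and> set xs \<subseteq> carrier R \<and> Idl\<^bsub>R\<^esub> (set xs) = carrier R}"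

definition stable_range_1 :: "('a, 'b) ring_scheme \<Rightarrow> bool" where
  "stable_range_1 S \<longleftrightarrow>
     (\<forall>a b. [a, b] \<in> Um S 2 \<longrightarrow> (\<exists>r \<in> carrier S. a \<oplus>\<^bsub>S\<^esub> b \<otimes>\<^bsub>S\<^esub> r \<in> Units S))"

definition almost_stable_range_1 :: "('a, 'b) ring_scheme \<Rightarrow> bool" where
  "almost_stable_range_1 R \<longleftrightarrow>
     (\<forall>I. ideal I R \<and> \<not> I \<subseteq> jacobson_radical R \<longrightarrow> stable_range_1 (R Quot I))"

definition mats :: "('a, 'b) ring_scheme \<Rightarrow> nat \<Rightarrow> nat \<Rightarrow> 'a mat set" where
  "mats R m n = {A \<in> carrier_mat m n. elements_mat A \<subseteq> carrier R}"

definition mmult :: "('a, 'b) ring_scheme \<Rightarrow> 'a mat \<Rightarrow> 'a mat \<Rightarrow> 'a mat" where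
  "mmult R A B = mat (dim_row A) (dim_col B)
     (\<lambda>(i, j). \<Oplus>\<^bsub>R\<^esub>k \<in> {..<dim_col A}. A $$ (i, k) \<otimes>\<^bsub>R\<^esub> B $$ (k, j))"

definition mone :: "('a, 'b) ring_scheme \<Rightarrow> nat \<Rightarrow> 'a mat" where
  "mone R n = mat n n (\<lambda>(i, j). if i = j then \<one>\<^bsub>R\<^esub> else \<zero>\<^bsub>R\<^esub>)"

definition GL :: "('a, 'b) ring_scheme \<Rightarrow> nat \<Rightarrow> 'a mat set" where
  "GL R n = {P \<in> mats R n n. \<exists>Q \<in> mats R n n. mmult R P Q = mone R n \<and> mmult R Q P = mone R n}"

definition mdet :: "('a, 'b) ring_scheme \<Rightarrow> 'a mat \<Rightarrow> 'a" where
  "mdet R A = (\<Oplus>\<^bsub>R\<^esub>p \<in> {p. p permutes {..<dim_row A}}.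
     let t = \<Otimes>\<^bsub>R\<^esub>i \<in> {..<dim_row A}. A $$ (i, p i) in if evenperm p then t else \<ominus>\<^bsub>R\<^esub> t)"

definition SL :: "('a, 'b) ring_scheme \<Rightarrow> nat \<Rightarrow> 'a mat set" where
  "SL R n = {A \<in> mats R n n. mdet R A = \<one>\<^bsub>R\<^esub>}"

definition Um_mat2 :: "('a, 'b) ring_scheme \<Rightarrow> 'a mat set" where
  "Um_mat2 R = {A \<in> mats R 2 2. Idl\<^bsub>R\<^esub> (elements_mat A) = carrier R}"

definition simply_extendable :: "('a, 'b) ring_scheme \<Rightarrow> 'a mat \<Rightarrow> bool" where
  "simply_extendable R A \<longleftrightarrow>
     (\<exists>B \<in> SL R 3. (\<forall>i<2. \<forall>j<2. B $$ (i, j) = A $$ (i, j)) \<and> B $$ (2, 2) = \<zero>\<^bsub>R\<^esub>)"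

definition SE2_triangle_ring :: "('a, 'b) ring_scheme \<Rightarrow> bool" where
  "SE2_triangle_ring R \<longleftrightarrow>
     (\<forall>A \<in> Um_mat2 R. A $$ (1, 0) = \<zero>\<^bsub>R\<^esub> \<or> A $$ (0, 1) = \<zero>\<^bsub>R\<^esub> \<longrightarrow> simply_extendable R A)"

definition admits_diagonal_reduction ::
    "('a, 'b) ring_scheme \<Rightarrow> nat \<Rightarrow> nat \<Rightarrow> 'a mat \<Rightarrow> bool" where
  "admits_diagonal_reduction R m n A \<longleftrightarrow>
     (\<exists>P \<in> GL R m. \<exists>Q \<in> GL R n. \<exists>D. D = mmult R (mmult R P A) Q \<and>
        (\<forall>i<m. \<forall>j<n. i \<noteq> j \<longrightarrow> D $$ (i, j) = \<zero>\<^bsub>R\<^esub>) \<and>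
        (\<forall>i. i + 1 < min m n \<longrightarrow> D $$ (i, i) divides\<^bsub>R\<^esub> D $$ (i + 1, i + 1)))"

definition hermite_ring :: "('a, 'b) ring_scheme \<Rightarrow> bool" where
  "hermite_ring R \<longleftrightarrow> (\<forall>A \<in> mats R 1 2. admits_diagonal_reduction R 1 2 A)"

definition elementary_divisor_ring :: "('a, 'b) ring_scheme \<Rightarrow> bool" where
  "elementary_divisor_ring R \<longleftrightarrow>
     (\<forall>m\<ge>1. \<forall>n\<ge>1. \<forall>A \<in> mats R m n. admits_diagonal_reduction R m n A)"

end

theory Submission
  imports Defs
begin

text \<open>
  If \<open>a, b, d\<close> generate the unit ideal, then for some \<open>p, q\<close> so do \<open>p b + q d\<close> and \<open>p a\<close>:
  if \<open>a\<close> lies in the Jacobson radical, then \<open>b v + d w\<close> is a unit for suitable \<open>v, w\<close> and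
  \<open>(p, q) = (v, w)\<close> works, otherwise \<open>R/aR\<close> has stable range 1, some \<open>b + d r\<close> is a unit modulo
  \<open>a\<close>, and \<open>(p, q) = (1, r)\<close> works.  The determinant of a \<open>3 \<times> 3\<close> matrix with lower right
  entry 0 is exactly such a combination, which gives (1).  Over a Hermite ring the same fact
  produces, by one row and one column operation, the gcd of the entries of
  \<open>[[x, y], [z, 0]]\<close> in its upper left corner.

  For (2), let \<open>z\<close> be an entry in the first column that divides everything in its own and the lower
  rows, with its row otherwise cleared.  Clear the row above except for its first two entries
  \<open>x, y\<close>, without touching the first column, and treat the block \<open>[[x, y], [z, 0]]\<close>: the
  upper left corner then divides everything from one row higher on.  Working up to the top row and
  then iterating on the remaining rows and columns gives the diagonal form.
\<close>

subsection \<open>Almost stable range 1\<close>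

context cring
begin

text \<open>Zorn's lemma, applied to the ideals that contain \<open>a\<close> and avoid
  \<open>\<one>\<close>: the union of a nonempty chain of them is another one, and a maximal member
  is a maximal ideal.\<close>

lemma nonunit_in_maximalideal:
  assumes a: "a \<in> carrier R" "a \<notin> Units R"
  shows "\<exists>M. maximalideal M R \<and> a \<in> M"
proof -
  define F where "F = {I. ideal I R \<and> a \<in> I \<and> \<one> \<notin> I}"
  \<comment> \<open>If \<open>\<one>\<close> were a multiple of \<open>a\<close>, then
    \<open>a\<close> would be a unit.\<close>
  have P: "PIdl a \<in> F"
    using a cgenideal_ideal cgenideal_self m_comm unfolding F_def Units_def cgenideal_def by auto
  have "\<exists>M\<in>F. \<forall>X\<in>F. M \<subseteq> X \<longrightarrow> X = M"
  proof (rule subset_Zorn_nonempty)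
    show "F \<noteq> {}" using P by blast
    fix C assume C: "C \<noteq> {}" "subset.chain F C"
    then have id: "\<And>I. I \<in> C \<Longrightarrow> ideal I R" and lin: "\<And>I J. I \<in> C \<Longrightarrow> J \<in> C \<Longrightarrow> I \<subseteq> J \<or> J \<subseteq> I"
      and a: "\<And>I. I \<in> C \<Longrightarrow> a \<in> I" and one: "\<And>I. I \<in> C \<Longrightarrow> \<one> \<notin> I"
      unfolding F_def subset_chain_def by auto
    obtain I0 where I0: "I0 \<in> C" using C by blast
    have "ideal (\<Union>C) R"
    proof (rule idealI[OF ring_axioms])
      show "subgroup (\<Union>C) (add_monoid R)"
      proof (rule add.subgroupI)
        show "\<Union>C \<subseteq> carrier R" using id ideal.Icarr by fastforce
        show "\<Union>C \<noteq> {}" using I0 a by blast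
        show "\<ominus> x \<in> \<Union>C" if x: "x \<in> \<Union>C" for x
        proof -
          obtain I where I: "I \<in> C" "x \<in> I" using x by blast
          interpret ideal I R using id I by blast
          show ?thesis using I by blast
        qed
        show "x \<oplus> y \<in> \<Union>C" if x: "x \<in> \<Union>C" "y \<in> \<Union>C" for x y
        proof -
          obtain I where I: "I \<in> C" "x \<in> I" "y \<in> I" using x lin by blast
          interpret ideal I R using id I by blast
          show ?thesis using I by blast
        qed
      qed
      show "x \<otimes> y \<in> \<Union>C" "y \<otimes> x \<in> \<Union>C" if "y \<in> \<Union>C" "x \<in> carrier R" for x y
        using that id ideal.I_l_closed ideal.I_r_closed by fastforce+
    qed
    then show "\<Union>C \<in> F" using I0 a one unfolding F_def by auto
  qed
  then obtain M where M: "ideal M R" "a \<in> M" "\<one> \<notin> M" and max: "\<And>J. J \<in> F \<Longrightarrow> M \<subseteq> J \<Longrightarrow> J = M"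
    unfolding F_def by blast
  have "maximalideal M R"
  proof (rule maximalidealI[OF M(1)])
    show "carrier R \<noteq> M" using M(3) by blast
    show "J = M \<or> J = carrier R" if "ideal J R" "M \<subseteq> J" "J \<subseteq> carrier R" for J
      using that max[of J] M(2) ideal.one_imp_carrier unfolding F_def by blast
  qed
  then show ?thesis using M by blast
qed

text \<open>A maximal ideal containing \<open>e\<close> would also contain \<open>a\<close>, hence
  \<open>\<one>\<close>.\<close>

lemma jacobson_radical_unit:
  assumes a: "a \<in> jacobson_radical R" and u: "u \<in> carrier R" and e: "e \<in> carrier R"
    and eq: "a \<otimes> u \<oplus> e = \<one>"
  shows "e \<in> Units R"
proof (rule ccontr)
  assume "e \<notin> Units R"
  then obtain M where M: "maximalideal M R" "e \<in> M"
    using nonunit_in_maximalideal e by blast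
  interpret M: maximalideal M R by (rule M(1))
  have "a \<in> M" using a M(1) unfolding jacobson_radical_def by blast
  then have "\<one> \<in> M" using M(2) u eq M.I_r_closed M.a_closed by metis
  then show False using M.one_imp_carrier M.I_notcarr by blast
qed

end

text \<open>Modulo \<open>I\<close> the relation reads \<open>b v + d w = 1\<close>, so stable range
  1 of the quotient makes some \<open>b + d r\<close> a unit there. Representatives of the
  multiplier and of the inverse give \<open>r\<close> and \<open>s\<close>, which frees the
  conclusion from cosets.\<close>

lemma (in ideal) stable_range_1_quotient:
  assumes sr: "stable_range_1 (R Quot I)" and a: "a \<in> I"
    and c: "b \<in> carrier R" "d \<in> carrier R" "v \<in> carrier R" "w \<in> carrier R"
    and eq: "a \<oplus> (b \<otimes> v \<oplus> d \<otimes> w) = \<one>"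
  shows "\<exists>r\<in>carrier R. \<exists>s\<in>carrier R. \<one> \<ominus> (b \<oplus> d \<otimes> r) \<otimes> s \<in> I"
proof -
  let ?Q = "R Quot I"
  note Q = quotient_is_ring
  note h = ring_hom_memE[OF rcos_ring_hom]
  have ha: "I +> a = \<zero>\<^bsub>?Q\<^esub>"
    using a_rcos_zero[OF is_ideal a] unfolding FactRing_def by simp
  have surj: "\<exists>r\<in>carrier R. x = I +> r" if "x \<in> carrier ?Q" for x
    using that unfolding FactRing_def A_RCOSETS_def' by simp
  let ?S = "{I +> b, I +> d}"
  have S: "?S \<subseteq> carrier ?Q" using c h(1) by blast
  let ?K = "Idl\<^bsub>?Q\<^esub> ?S"
  have K: "ideal ?K ?Q" by (rule ring.genideal_ideal[OF Q S])
  have in_K: "I +> b \<in> ?K" "I +> d \<in> ?K"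
    using ring.genideal_self[OF Q S] by auto
  have "\<one>\<^bsub>?Q\<^esub> = I +> (a \<oplus> (b \<otimes> v \<oplus> d \<otimes> w))"
    unfolding eq h(4) ..
  also have "\<dots> = (I +> b) \<otimes>\<^bsub>?Q\<^esub> (I +> v) \<oplus>\<^bsub>?Q\<^esub> (I +> d) \<otimes>\<^bsub>?Q\<^esub> (I +> w)"
    using c h(1) Icarr[OF a] ring.ring_simprules(1)[OF Q] ring.ring_simprules(8)[OF Q] ring.ring_simprules(5)[OF Q]
    by (simp add: h(2,3) ha)
  also have "\<dots> \<in> ?K"
    using in_K c h(1) additive_subgroup.a_closed[OF ideal.axioms(1)[OF K]] ideal.I_r_closed[OF K] by blast
  finally have "?K = carrier ?Q" by (rule ideal.one_imp_carrier[OF K])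
  then have "[I +> b, I +> d] \<in> Um ?Q 2"
    unfolding Um_def using S by simp
  then obtain x where x: "x \<in> carrier ?Q"
      "(I +> b) \<oplus>\<^bsub>?Q\<^esub> (I +> d) \<otimes>\<^bsub>?Q\<^esub> x \<in> Units ?Q"
    using sr unfolding stable_range_1_def by blast
  obtain r where r: "r \<in> carrier R" "x = I +> r"
    using surj[OF x(1)] by blast
  have hbr: "(I +> b) \<oplus>\<^bsub>?Q\<^esub> (I +> d) \<otimes>\<^bsub>?Q\<^esub> x = I +> (b \<oplus> d \<otimes> r)"
    using r c h(1) by (simp add: h(2,3))
  obtain y where y: "y \<in> carrier ?Q" "(I +> (b \<oplus> d \<otimes> r)) \<otimes>\<^bsub>?Q\<^esub> y = \<one>\<^bsub>?Q\<^esub>"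
    using monoid.Units_r_inv_ex[OF ring.is_monoid[OF Q] x(2)] unfolding hbr by blast
  obtain s where s: "s \<in> carrier R" "y = I +> s"
    using surj[OF y(1)] by blast
  have br: "b \<oplus> d \<otimes> r \<in> carrier R" using r c by simp
  have "I +> \<one> = I +> ((b \<oplus> d \<otimes> r) \<otimes> s)"
    using y(2) unfolding s(2) h(2)[OF br s(1)] h(4) by simp
  then have "\<one> \<ominus> (b \<oplus> d \<otimes> r) \<otimes> s \<in> I"
    using quotient_eq_iff_same_a_r_cos[OF is_ideal, of "\<one>" "(b \<oplus> d \<otimes> r) \<otimes> s"] s(1) br by simp
  then show ?thesis using r(1) s(1) by blast
qed

context cring
begin

lemma asr1_unimodular:
  assumes asr: "almost_stable_range_1 R"
    and c: "a \<in> carrier R" "b \<in> carrier R" "d \<in> carrier R"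
      "u \<in> carrier R" "v \<in> carrier R" "w \<in> carrier R"
    and eq: "a \<otimes> u \<oplus> (b \<otimes> v \<oplus> d \<otimes> w) = \<one>"
  shows "\<exists>p\<in>carrier R. \<exists>q\<in>carrier R. \<exists>s\<in>carrier R. \<exists>t\<in>carrier R.
    (p \<otimes> b \<oplus> q \<otimes> d) \<otimes> s \<oplus> (p \<otimes> a) \<otimes> t = \<one>"
proof (cases "a \<in> jacobson_radical R")
  case True
  then have "b \<otimes> v \<oplus> d \<otimes> w \<in> Units R"
    using jacobson_radical_unit[OF True _ _ eq] c by simp
  then obtain s where s: "s \<in> carrier R" "(b \<otimes> v \<oplus> d \<otimes> w) \<otimes> s = \<one>"
    using Units_r_inv_ex by blast
  \<comment> \<open>The unit already generates everything, so the coefficient of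
    \<open>v \<otimes> a\<close> can be zero.\<close>
  have "(v \<otimes> b \<oplus> w \<otimes> d) \<otimes> s \<oplus> (v \<otimes> a) \<otimes> \<zero> = \<one>"
    using s c by (simp add: m_comm[of v] m_comm[of w])
  then show ?thesis using c s(1) zero_closed by blast
next
  case False
  have I: "ideal (PIdl a) R" by (rule cgenideal_ideal[OF c(1)])
  have aI: "a \<in> PIdl a" by (rule cgenideal_self[OF c(1)])
  have "stable_range_1 (R Quot (PIdl a))"
    using asr False aI I unfolding almost_stable_range_1_def by blast
  \<comment> \<open>The quotient lemma is used with \<open>a \<otimes> u\<close> as the element of
    the ideal.\<close>
  then obtain r s where rs: "r \<in> carrier R" "s \<in> carrier R" "\<one> \<ominus> (b \<oplus> d \<otimes> r) \<otimes> s \<in> PIdl a"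
    using ideal.stable_range_1_quotient[OF I _ ideal.I_r_closed[OF I aI c(4)] c(2,3,5,6) eq]
    by blast
  \<comment> \<open>The coefficient \<open>t\<close> of \<open>a\<close> completes the relation with
    \<open>p = \<one>\<close> and \<open>q = r\<close>.\<close>
  then obtain t where t: "t \<in> carrier R" "\<one> \<ominus> (b \<oplus> d \<otimes> r) \<otimes> s = t \<otimes> a"
    unfolding cgenideal_def by blast
  let ?z = "(b \<oplus> d \<otimes> r) \<otimes> s"
  have z: "?z \<in> carrier R" using rs c by simp
  have "?z \<oplus> (\<one> \<ominus> ?z) = \<one>"
    using z by (simp add: minus_eq a_lcomm r_neg)
  then have "?z \<oplus> t \<otimes> a = \<one>" unfolding t(2) .
  then have "(\<one> \<otimes> b \<oplus> r \<otimes> d) \<otimes> s \<oplus> (\<one> \<otimes> a) \<otimes> t = \<one>"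
    using rs c t by (simp add: m_comm[of r] m_comm[of t])
  then show ?thesis using rs t one_closed by blast
qed

text \<open>The sum of the three principal ideals is an ideal containing \<open>S\<close>, hence
  contains \<open>\<one>\<close>. The set of entries of a triangular matrix has the form of
  \<open>S\<close>, with \<open>\<zero>\<close> for the vanishing corner.\<close>

lemma Idl_three_eq_carrier:
  assumes c: "a \<in> carrier R" "b \<in> carrier R" "d \<in> carrier R"
    and S: "S \<subseteq> {\<zero>, a, b, d}" and eq: "Idl S = carrier R"
  shows "\<exists>u\<in>carrier R. \<exists>v\<in>carrier R. \<exists>w\<in>carrier R. a \<otimes> u \<oplus> (b \<otimes> v \<oplus> d \<otimes> w) = \<one>"
proof -
  let ?K = "PIdl a <+>\<^bsub>R\<^esub> (PIdl b <+>\<^bsub>R\<^esub> PIdl d)"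
  have "ideal ?K R" using c by (intro add_ideals cgenideal_ideal)
  have prin: "x \<otimes> y \<in> PIdl x" if "x \<in> carrier R" "y \<in> carrier R" for x y
    unfolding cgenideal_def using that m_comm[of x y] by blast
  have sum: "x \<oplus> y \<in> H <+>\<^bsub>R\<^esub> K" if "x \<in> H" "y \<in> K" for x y H K
    using that unfolding set_add_def' by blast
  have mem: "a \<otimes> u \<oplus> (b \<otimes> v \<oplus> d \<otimes> w) \<in> ?K"
    if "u \<in> carrier R" "v \<in> carrier R" "w \<in> carrier R" for u v w
    by (intro sum prin c that)
  have "{\<zero>, a, b, d} \<subseteq> ?K"
    using mem[of "\<zero>" "\<zero>" "\<zero>"] mem[of "\<one>" "\<zero>" "\<zero>"] mem[of "\<zero>" "\<one>" "\<zero>"] mem[of "\<zero>" "\<zero>" "\<one>"] c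
    by simp
  then have "carrier R \<subseteq> ?K"
    using genideal_minimal[OF \<open>ideal ?K R\<close>, of S] S eq by auto
  then have "\<one> \<in> ?K" using one_closed by (rule subsetD)
  then obtain u v w where "u \<in> carrier R" "v \<in> carrier R" "w \<in> carrier R"
      "\<one> = u \<otimes> a \<oplus> (v \<otimes> b \<oplus> w \<otimes> d)"
    unfolding set_add_def' cgenideal_def by auto
  then show ?thesis using c m_comm by metis
qed

end

subsection \<open>Simple extensions of triangular matrices\<close>

text \<open>A permutation of \<open>insert a S\<close> is a transposition moving \<open>a\<close>,
  or the identity, after a permutation of \<open>S\<close>; unfolding this twice gives the list in
  this form.\<close>

lemma permutes_three:
  "{p. p permutes {..<3::nat}} =
    {id, transpose 1 2, transpose 0 1, transpose 0 1 \<circ> transpose 1 2,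
      transpose 0 2, transpose 0 2 \<circ> transpose 1 2}"
proof -
  have *: "{..<3::nat} = insert 0 (insert 1 (insert 2 {}))" by auto
  have ins: "{p. p permutes insert a S} = (\<lambda>(b, p). transpose a b \<circ> p) ` (insert a S \<times> {p. p permutes S})"
    for a :: nat and S
    unfolding permutes_insert by (rule arg_cong) auto
  have "{p. p permutes {..<3::nat}} =
    (\<lambda>(b, p). transpose 0 b \<circ> p) ` ({0, 1, 2} \<times> ((\<lambda>(b, p). transpose 1 b \<circ> p) ` ({1, 2} \<times> {id})))"
    unfolding * ins by simp
  also have "\<dots> = {id, transpose 1 2, transpose 0 1, transpose 0 1 \<circ> transpose 1 2,
      transpose 0 2, transpose 0 2 \<circ> transpose 1 2}"
    by (simp add: insert_Times_insert insert_commute)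
  finally show ?thesis .
qed

context cring
begin

text \<open>The Leibniz expansion. The two products through the entry \<open>(2,2)\<close> stand
  first; they vanish for a simple extension.\<close>

lemma mdet_3:
  assumes B: "dim_row B = 3" "\<And>i j. i < 3 \<Longrightarrow> j < 3 \<Longrightarrow> B $$ (i, j) \<in> carrier R"
  shows "mdet R B =
    B $$ (0,0) \<otimes> B $$ (1,1) \<otimes> B $$ (2,2) \<oplus> (\<ominus> (B $$ (0,1) \<otimes> B $$ (1,0) \<otimes> B $$ (2,2)) \<oplus>
    (\<ominus> (B $$ (0,2) \<otimes> B $$ (1,1) \<otimes> B $$ (2,0)) \<oplus> (\<ominus> (B $$ (0,0) \<otimes> B $$ (1,2) \<otimes> B $$ (2,1)) \<oplus>
    (B $$ (0,1) \<otimes> B $$ (1,2) \<otimes> B $$ (2,0) \<oplus> B $$ (0,2) \<otimes> B $$ (1,0) \<otimes> B $$ (2,1)))))"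
proof -
  have *: "{..<3::nat} = insert 0 (insert 1 (insert 2 {}))" by auto
  have distinct: "distinct [id :: nat \<Rightarrow> nat, transpose 1 2, transpose 0 1, transpose 0 1 \<circ> transpose 1 2,
     transpose 0 2, transpose 0 2 \<circ> transpose 1 2]"
  proof -
    \<comment> \<open>The values at 0 and 1 tell the six permutations apart.\<close>
    have "distinct (map (\<lambda>p. (p (0::nat), p (1::nat))) [id :: nat \<Rightarrow> nat, transpose 1 2, transpose 0 1, transpose 0 1 \<circ> transpose 1 2,
     transpose 0 2, transpose 0 2 \<circ> transpose 1 2])"
      by (simp add: transpose_def)
    then show ?thesis by (simp only: distinct_map)
  qed
  have t: "(\<Otimes>i\<in>{..<3}. B $$ (i, p i)) = B $$ (0, p 0) \<otimes> B $$ (1, p 1) \<otimes> B $$ (2, p 2)"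
    if "p permutes {..<3}" for p
    using B(2) permutes_in_image[OF that, of 0] permutes_in_image[OF that, of 1] permutes_in_image[OF that, of 2]
    unfolding * by (auto simp: m_assoc)
  have perm: "p permutes {..<3}" if "p \<in> {id, transpose 1 2, transpose 0 1, transpose 0 1 \<circ> transpose 1 2,
      transpose 0 2, transpose 0 2 \<circ> transpose 1 2}" for p :: "nat \<Rightarrow> nat"
    using that unfolding permutes_three[symmetric] by simp
  have ev: "evenperm (transpose (0::nat) 1 \<circ> transpose 1 2)" "evenperm (transpose (0::nat) 2 \<circ> transpose 1 2)"
    by (simp_all add: evenperm_comp evenperm_swap permutation_swap_id)
  define g where "g p = (let t = \<Otimes>i\<in>{..<3}. B $$ (i, p i) in if evenperm p then t else \<ominus> t)" for p
  have cB: "B $$ (i, j) \<in> carrier R" if "i \<in> {0,1,2}" "j \<in> {0,1,2}" for i j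
    using B(2) that by auto
  have gt: "g p = (if evenperm p then B $$ (0, p 0) \<otimes> B $$ (1, p 1) \<otimes> B $$ (2, p 2)
      else \<ominus> (B $$ (0, p 0) \<otimes> B $$ (1, p 1) \<otimes> B $$ (2, p 2)))" if "p permutes {..<3}" for p
    unfolding g_def Let_def t[OF that] ..
  have g: "g id = B $$ (0,0) \<otimes> B $$ (1,1) \<otimes> B $$ (2,2)"
    "g (transpose 1 2) = \<ominus> (B $$ (0,0) \<otimes> B $$ (1,2) \<otimes> B $$ (2,1))"
    "g (transpose 0 1) = \<ominus> (B $$ (0,1) \<otimes> B $$ (1,0) \<otimes> B $$ (2,2))"
    "g (transpose 0 2) = \<ominus> (B $$ (0,2) \<otimes> B $$ (1,1) \<otimes> B $$ (2,0))"
    "g (transpose 0 1 \<circ> transpose 1 2) = B $$ (0,1) \<otimes> B $$ (1,2) \<otimes> B $$ (2,0)"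
    "g (transpose 0 2 \<circ> transpose 1 2) = B $$ (0,2) \<otimes> B $$ (1,0) \<otimes> B $$ (2,1)"
    by (simp_all only: gt[OF perm] insert_iff simp_thms ev evenperm_id evenperm_swap if_True)
      (simp_all add: transpose_def)
  have "mdet R B = (\<Oplus>p\<in>{id, transpose 1 2, transpose 0 1, transpose 0 1 \<circ> transpose 1 2,
      transpose 0 2, transpose 0 2 \<circ> transpose 1 2}. g p)"
    unfolding mdet_def B(1) g_def permutes_three ..
  also have "\<dots> = g id \<oplus> (g (transpose 1 2) \<oplus> (g (transpose 0 1) \<oplus> (g (transpose 0 1 \<circ> transpose 1 2) \<oplus>
      (g (transpose 0 2) \<oplus> g (transpose 0 2 \<circ> transpose 1 2)))))"
    using distinct by (simp add: cB g del: One_nat_def)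
  finally show ?thesis unfolding g by (simp add: cB a_ac)
qed

lemma mats_iff:
  "A \<in> mats R m n \<longleftrightarrow> A \<in> carrier_mat m n \<and> (\<forall>i<m. \<forall>j<n. A $$ (i, j) \<in> carrier R)"
  unfolding mats_def elements_mat_def by fastforce

text \<open>Border \<open>A\<close> with the column \<open>(x, y)\<close>, the row
  \<open>(z, w)\<close> and the corner \<open>\<zero>\<close>: the left side of \<open>eq\<close> is
  the determinant of the result.\<close>

lemma simply_extendableI:
  assumes A: "A \<in> mats R 2 2" and c: "x \<in> carrier R" "y \<in> carrier R" "z \<in> carrier R" "w \<in> carrier R"
    and eq: "\<ominus> (x \<otimes> A $$ (1,1) \<otimes> z) \<oplus> (\<ominus> (A $$ (0,0) \<otimes> y \<otimes> w) \<oplus>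
      (A $$ (0,1) \<otimes> y \<otimes> z \<oplus> x \<otimes> A $$ (1,0) \<otimes> w)) = \<one>"
  shows "simply_extendable R A"
proof -
  define f where "f i j = (if i < 2 \<and> j < 2 then A $$ (i, j)
    else if i = (0::nat) then x else if i = 1 then y
    else if j = (0::nat) then z else if j = 1 then w else \<zero>)" for i j
  let ?B = "mat 3 3 (\<lambda>(i, j). f i j)"
  have cA: "A $$ (i, j) \<in> carrier R" if "i < 2" "j < 2" for i j
    using A that unfolding mats_iff by blast
  have cf: "f i j \<in> carrier R" for i j
    unfolding f_def using cA c by simp
  have B: "?B \<in> mats R 3 3"
    using cf unfolding mats_iff by simp
  have fA: "f i j = A $$ (i, j)" if "i < 2" "j < 2" for i j
    unfolding f_def using that by simp
  have fv: "f 0 2 = x" "f 1 2 = y" "f 2 0 = z" "f 2 1 = w" "f 2 2 = \<zero>"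
    unfolding f_def by simp_all
  have "mdet R ?B = \<ominus> (x \<otimes> A $$ (1,1) \<otimes> z) \<oplus> (\<ominus> (A $$ (0,0) \<otimes> y \<otimes> w) \<oplus>
      (A $$ (0,1) \<otimes> y \<otimes> z \<oplus> x \<otimes> A $$ (1,0) \<otimes> w))"
    using mdet_3[of ?B] cf c cA by (simp add: fA fv fv[unfolded One_nat_def] del: One_nat_def)
  then have "?B \<in> SL R 3" unfolding SL_def eq using B by blast
  then show ?thesis unfolding simply_extendable_def
    by (rule bexI[rotated]) (auto simp: fA fv)
qed

text \<open>For an upper triangular matrix with entries \<open>a, b, d\<close>, the border with
  column \<open>(-q, p)\<close> and row \<open>(s, -t)\<close> has determinant
  \<open>(p b + q d) s + p a t\<close>, which \<open>asr1_unimodular\<close> makes equal to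
  1.\<close>

lemma asr1_SE2_triangle:
  assumes asr: "almost_stable_range_1 R"
  shows "SE2_triangle_ring R"
  unfolding SE2_triangle_ring_def
proof (intro ballI impI)
  fix A assume A: "A \<in> Um_mat2 R" and tri: "A $$ (1, 0) = \<zero> \<or> A $$ (0, 1) = \<zero>"
  define a b c d where abcd: "a = A $$ (0, 0)" "b = A $$ (0, 1)" "c = A $$ (1, 0)" "d = A $$ (1, 1)"
  have "A \<in> mats R 2 2 \<and> Idl (elements_mat A) = carrier R"
    using A unfolding Um_mat2_def by (rule CollectD)
  then have M: "A \<in> mats R 2 2" and Idl: "Idl (elements_mat A) = carrier R"
    by simp_all
  have cl: "a \<in> carrier R" "b \<in> carrier R" "c \<in> carrier R" "d \<in> carrier R"
    using M unfolding mats_iff abcd by auto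
  have el: "elements_mat A \<subseteq> {a, b, c, d}"
    using M unfolding mats_iff elements_mat_def abcd by (auto simp: less_2_cases_iff)
  show "simply_extendable R A"
  proof (cases "A $$ (1, 0) = \<zero>")
    case True
    then have sub: "elements_mat A \<subseteq> {\<zero>, a, b, d}" using el abcd by auto
    obtain u v w where uvw: "u \<in> carrier R" "v \<in> carrier R" "w \<in> carrier R"
        "a \<otimes> u \<oplus> (b \<otimes> v \<oplus> d \<otimes> w) = \<one>"
      using Idl_three_eq_carrier[OF cl(1,2,4) sub Idl] by (elim bexE)
    obtain p q s t where p: "p \<in> carrier R" "q \<in> carrier R" "s \<in> carrier R" "t \<in> carrier R"
        "(p \<otimes> b \<oplus> q \<otimes> d) \<otimes> s \<oplus> (p \<otimes> a) \<otimes> t = \<one>"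
      using asr1_unimodular[OF asr cl(1,2,4) uvw] by (elim bexE)
    show ?thesis
    proof (rule simply_extendableI[OF M, of "\<ominus> q" p s "\<ominus> t"], unfold abcd[symmetric])
      show "\<ominus> (\<ominus> q \<otimes> d \<otimes> s) \<oplus> (\<ominus> (a \<otimes> p \<otimes> \<ominus> t) \<oplus> (b \<otimes> p \<otimes> s \<oplus> \<ominus> q \<otimes> c \<otimes> \<ominus> t)) = \<one>"
        unfolding p(5)[symmetric] using True p(1-4) cl
        by (simp add: abcd(3) l_minus r_minus l_distr r_distr m_ac a_ac)
    qed (use p in auto)
  next
    \<comment> \<open>The lower triangular case exchanges \<open>a\<close> with \<open>d\<close> and
      \<open>b\<close> with \<open>c\<close>; both the new column and the new row are reversed
      accordingly.\<close>
    case False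
    then have b: "b = \<zero>" using tri abcd by simp
    then have sub: "elements_mat A \<subseteq> {\<zero>, d, c, a}" using el by auto
    obtain u v w where uvw: "u \<in> carrier R" "v \<in> carrier R" "w \<in> carrier R"
        "d \<otimes> u \<oplus> (c \<otimes> v \<oplus> a \<otimes> w) = \<one>"
      using Idl_three_eq_carrier[OF cl(4,3,1) sub Idl] by (elim bexE)
    obtain p q s t where p: "p \<in> carrier R" "q \<in> carrier R" "s \<in> carrier R" "t \<in> carrier R"
        "(p \<otimes> c \<oplus> q \<otimes> a) \<otimes> s \<oplus> (p \<otimes> d) \<otimes> t = \<one>"
      using asr1_unimodular[OF asr cl(4,3,1) uvw] by (elim bexE)
    show ?thesis
    proof (rule simply_extendableI[OF M, of p "\<ominus> q" "\<ominus> t" s], unfold abcd[symmetric])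
      show "\<ominus> (p \<otimes> d \<otimes> \<ominus> t) \<oplus> (\<ominus> (a \<otimes> \<ominus> q \<otimes> s) \<oplus> (b \<otimes> \<ominus> q \<otimes> \<ominus> t \<oplus> p \<otimes> c \<otimes> s)) = \<one>"
        unfolding p(5)[symmetric] b using p(1-4) cl
        by (simp add: l_minus r_minus l_distr r_distr m_ac a_ac)
    qed (use p in auto)
  qed
qed

end

subsection \<open>Matrices and two-by-two operations\<close>

text \<open>The identity matrix as a function on all index pairs, so that operations apply to it
  without index bounds.\<close>

definition idf :: "('a, 'b) ring_scheme \<Rightarrow> nat \<Rightarrow> nat \<Rightarrow> 'a" where
  "idf R a b = (if a = b then \<one>\<^bsub>R\<^esub> else \<zero>\<^bsub>R\<^esub>)"

text \<open>Left multiplication of rows \<open>i\<close> and \<open>j\<close> by the block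
  \<open>[[p, q], [r, s]]\<close>. General blocks are allowed because Bezout coefficients form them
  directly.\<close>

definition rowop ::
    "('a, 'b) ring_scheme \<Rightarrow> nat \<Rightarrow> nat \<Rightarrow> 'a \<Rightarrow> 'a \<Rightarrow> 'a \<Rightarrow> 'a \<Rightarrow> (nat \<Rightarrow> nat \<Rightarrow> 'a) \<Rightarrow> nat \<Rightarrow> nat \<Rightarrow> 'a" where
  "rowop R i j p q r s f = (\<lambda>a b.
     if a = i then p \<otimes>\<^bsub>R\<^esub> f i b \<oplus>\<^bsub>R\<^esub> q \<otimes>\<^bsub>R\<^esub> f j b
     else if a = j then r \<otimes>\<^bsub>R\<^esub> f i b \<oplus>\<^bsub>R\<^esub> s \<otimes>\<^bsub>R\<^esub> f j b
     else f a b)"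

text \<open>The row operation on the transpose: column \<open>i\<close> becomes \<open>p\<close>
  times column \<open>i\<close> plus \<open>q\<close> times column \<open>j\<close>. Facts on rows
  thus carry over to columns.\<close>

definition colop ::
    "('a, 'b) ring_scheme \<Rightarrow> nat \<Rightarrow> nat \<Rightarrow> 'a \<Rightarrow> 'a \<Rightarrow> 'a \<Rightarrow> 'a \<Rightarrow> (nat \<Rightarrow> nat \<Rightarrow> 'a) \<Rightarrow> nat \<Rightarrow> nat \<Rightarrow> 'a" where
  "colop R i j p q r s f = (\<lambda>a b. rowop R i j p q r s (\<lambda>b a. f a b) b a)"

text \<open>The blocks \<open>[[p, q], [r, s]]\<close> and \<open>[[p', q'], [r', s']]\<close> are
  mutually inverse, with the products in both orders spelled out.\<close>

definition inverse2 ::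
    "('a, 'b) ring_scheme \<Rightarrow> 'a \<Rightarrow> 'a \<Rightarrow> 'a \<Rightarrow> 'a \<Rightarrow> 'a \<Rightarrow> 'a \<Rightarrow> 'a \<Rightarrow> 'a \<Rightarrow> bool" where
  "inverse2 R p q r s p' q' r' s' \<longleftrightarrow>
     {p, q, r, s, p', q', r', s'} \<subseteq> carrier R \<and>
     p \<otimes>\<^bsub>R\<^esub> p' \<oplus>\<^bsub>R\<^esub> q \<otimes>\<^bsub>R\<^esub> r' = \<one>\<^bsub>R\<^esub> \<and> p \<otimes>\<^bsub>R\<^esub> q' \<oplus>\<^bsub>R\<^esub> q \<otimes>\<^bsub>R\<^esub> s' = \<zero>\<^bsub>R\<^esub> \<and>
     r \<otimes>\<^bsub>R\<^esub> p' \<oplus>\<^bsub>R\<^esub> s \<otimes>\<^bsub>R\<^esub> r' = \<zero>\<^bsub>R\<^esub> \<and> r \<otimes>\<^bsub>R\<^esub> q' \<oplus>\<^bsub>R\<^esub> s \<otimes>\<^bsub>R\<^esub> s' = \<one>\<^bsub>R\<^esub> \<and>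
     p' \<otimes>\<^bsub>R\<^esub> p \<oplus>\<^bsub>R\<^esub> q' \<otimes>\<^bsub>R\<^esub> r = \<one>\<^bsub>R\<^esub> \<and> p' \<otimes>\<^bsub>R\<^esub> q \<oplus>\<^bsub>R\<^esub> q' \<otimes>\<^bsub>R\<^esub> s = \<zero>\<^bsub>R\<^esub> \<and>
     r' \<otimes>\<^bsub>R\<^esub> p \<oplus>\<^bsub>R\<^esub> s' \<otimes>\<^bsub>R\<^esub> r = \<zero>\<^bsub>R\<^esub> \<and> r' \<otimes>\<^bsub>R\<^esub> q \<oplus>\<^bsub>R\<^esub> s' \<otimes>\<^bsub>R\<^esub> s = \<one>\<^bsub>R\<^esub>"

context cring
begin

lemma inverse2_sym: "inverse2 R p q r s p' q' r' s' \<Longrightarrow> inverse2 R p' q' r' s' p q r s"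
  unfolding inverse2_def by auto

lemma inverse2_closed:
  assumes "inverse2 R p q r s p' q' r' s'"
  shows "p \<in> carrier R" "q \<in> carrier R" "r \<in> carrier R" "s \<in> carrier R"
  using assms unfolding inverse2_def by auto

text \<open>A unimodular row is completed to a block of determinant 1, whose inverse is its
  adjugate.\<close>

lemma inverse2_unimodular:
  assumes c: "p \<in> carrier R" "q \<in> carrier R" "u \<in> carrier R" "v \<in> carrier R"
    and eq: "p \<otimes> u \<oplus> q \<otimes> v = \<one>"
  shows "inverse2 R p q (\<ominus> v) u u (\<ominus> q) v p"
proof -
  have eq': "u \<otimes> p \<oplus> v \<otimes> q = \<one>" using eq c m_comm by simp
  then have "v \<otimes> q \<oplus> u \<otimes> p = \<one>" using c a_comm by simp
  then show ?thesis unfolding inverse2_def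
    using eq eq' c by (simp add: l_minus r_minus m_comm r_neg l_neg a_comm)
qed

lemma rowop_closed:
  assumes "\<And>a b. f a b \<in> carrier R" "p \<in> carrier R" "q \<in> carrier R" "r \<in> carrier R" "s \<in> carrier R"
  shows "rowop R i j p q r s f a b \<in> carrier R"
  unfolding rowop_def using assms by simp

lemma lin_comb2:
  assumes "p \<in> carrier R" "q \<in> carrier R" "p' \<in> carrier R" "q' \<in> carrier R" "r' \<in> carrier R" "s' \<in> carrier R"
    "x \<in> carrier R" "y \<in> carrier R"
  shows "p \<otimes> (p' \<otimes> x \<oplus> q' \<otimes> y) \<oplus> q \<otimes> (r' \<otimes> x \<oplus> s' \<otimes> y) =
    (p \<otimes> p' \<oplus> q \<otimes> r') \<otimes> x \<oplus> (p \<otimes> q' \<oplus> q \<otimes> s') \<otimes> y"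
  using assms by (simp add: l_distr r_distr m_assoc a_ac)

lemma rowop_inverse:
  assumes inv: "inverse2 R p q r s p' q' r' s'" and ij: "i \<noteq> j" and f: "\<And>a b. f a b \<in> carrier R"
  shows "rowop R i j p q r s (rowop R i j p' q' r' s' f) = f"
proof -
  note c = inverse2_closed[OF inv] inverse2_closed[OF inverse2_sym[OF inv]]
  show ?thesis
    using inv ij f c unfolding rowop_def inverse2_def by (intro ext) (simp add: lin_comb2)
qed

lemma colop_inverse:
  assumes "inverse2 R p q r s p' q' r' s'" "i \<noteq> j" "\<And>a b. f a b \<in> carrier R"
  shows "colop R i j p q r s (colop R i j p' q' r' s' f) = f"
  unfolding colop_def using rowop_inverse[OF assms(1,2), of "\<lambda>b a. f a b"] assms(3) by simp

section \<open>Finite sums and the Kronecker delta\<close>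

lemma idf_closed: "idf R a b \<in> carrier R"
  unfolding idf_def by simp

lemma idf_commute: "idf R a b = idf R b a"
  unfolding idf_def by simp

lemma finsum_idf:
  assumes "a < n" "\<And>k. f k \<in> carrier R"
  shows "(\<Oplus>k\<in>{..<n::nat}. idf R a k \<otimes> f k) = f a"
proof -
  have "(\<Oplus>k\<in>{..<n}. idf R a k \<otimes> f k) = (\<Oplus>k\<in>{..<n}. if a = k then f k else \<zero>)"
    using assms by (intro finsum_cong') (auto simp: idf_def)
  also have "\<dots> = f a" using assms by (intro add.finprod_singleton) auto
  finally show ?thesis .
qed

text \<open>The changed rows of the matrix of a row operation are such combinations of two rows of
  the identity, so this computes an entry of its product with another matrix.\<close>

lemma finsum_idf2:
  assumes "i < n" "j < n" "\<And>k. f k \<in> carrier R" "p \<in> carrier R" "q \<in> carrier R"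
  shows "(\<Oplus>k\<in>{..<n::nat}. (p \<otimes> idf R i k \<oplus> q \<otimes> idf R j k) \<otimes> f k) = p \<otimes> f i \<oplus> q \<otimes> f j"
proof -
  have "(\<Oplus>k\<in>{..<n}. (p \<otimes> idf R i k \<oplus> q \<otimes> idf R j k) \<otimes> f k) =
      (\<Oplus>k\<in>{..<n}. p \<otimes> (idf R i k \<otimes> f k) \<oplus> q \<otimes> (idf R j k \<otimes> f k))"
    using assms idf_closed by (intro finsum_cong') (auto simp: l_distr m_assoc)
  also have "\<dots> = (\<Oplus>k\<in>{..<n}. p \<otimes> (idf R i k \<otimes> f k)) \<oplus> (\<Oplus>k\<in>{..<n}. q \<otimes> (idf R j k \<otimes> f k))"
    using assms idf_closed by (intro finsum_addf) auto
  also have "\<dots> = p \<otimes> (\<Oplus>k\<in>{..<n}. idf R i k \<otimes> f k) \<oplus> q \<otimes> (\<Oplus>k\<in>{..<n}. idf R j k \<otimes> f k)"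
    using assms idf_closed by (subst (1 2) finsum_rdistr) auto
  finally show ?thesis using assms by (simp add: finsum_idf)
qed

lemma finsum_swap:
  assumes "finite A" "finite B" "\<And>i j. f i j \<in> carrier R"
  shows "(\<Oplus>i\<in>A. \<Oplus>j\<in>B. f i j) = (\<Oplus>j\<in>B. \<Oplus>i\<in>A. f i j)"
  using assms(1)
proof (induction A rule: finite_induct)
  case empty
  then show ?case using assms(2) by (simp add: finsum_zero)
next
  case (insert x A)
  have "(\<Oplus>i\<in>insert x A. \<Oplus>j\<in>B. f i j) = (\<Oplus>j\<in>B. f x j) \<oplus> (\<Oplus>j\<in>B. \<Oplus>i\<in>A. f i j)"
    using insert assms by (simp add: finsum_closed Pi_def)
  also have "\<dots> = (\<Oplus>j\<in>B. f x j \<oplus> (\<Oplus>i\<in>A. f i j))"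
    using assms by (intro finsum_addf[symmetric]) (auto intro!: finsum_closed)
  also have "\<dots> = (\<Oplus>j\<in>B. \<Oplus>i\<in>insert x A. f i j)"
    using insert assms by (intro finsum_cong') (auto simp: finsum_closed Pi_def)
  finally show ?case .
qed

section \<open>Matrix algebra over the carrier\<close>

lemma mat_in_mats: "(\<And>a b. f a b \<in> carrier R) \<Longrightarrow> mat m n (\<lambda>(a, b). f a b) \<in> mats R m n"
  unfolding mats_iff by simp

text \<open>Extension by zero turns the entries into a total function with values in the carrier, so
  that sums need no side conditions on indices.\<close>

lemma mats_fun:
  assumes "A \<in> mats R m n"
  shows "A = mat m n (\<lambda>(i, j). if i < m \<and> j < n then A $$ (i, j) else \<zero>)"
    and "(if i < m \<and> j < n then A $$ (i, j) else \<zero>) \<in> carrier R"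
  using assms unfolding mats_iff by auto

lemma mats_obtain_fun:
  assumes "A \<in> mats R m n"
  obtains f where "\<And>i j. f i j \<in> carrier R" "A = mat m n (\<lambda>(i, j). f i j)"
  using mats_fun[OF assms] by (rule that[rotated])

lemma mmult_in_mats:
  assumes "A \<in> mats R m n" "B \<in> mats R n l"
  shows "mmult R A B \<in> mats R m l"
  using assms unfolding mats_iff mmult_def by (auto intro!: finsum_closed)

lemma mmult_mat:
  assumes "\<And>i j. f i j \<in> carrier R" "\<And>i j. g i j \<in> carrier R"
  shows "mmult R (mat m n (\<lambda>(i, j). f i j)) (mat n l (\<lambda>(i, j). g i j)) =
      mat m l (\<lambda>(i, j). \<Oplus>k\<in>{..<n}. f i k \<otimes> g k j)"
  unfolding mmult_def using assms by (auto intro!: eq_matI finsum_cong')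

lemma mmult_assoc:
  assumes A: "A \<in> mats R m n" and B: "B \<in> mats R n l" and C: "C \<in> mats R l h"
  shows "mmult R (mmult R A B) C = mmult R A (mmult R B C)"
proof -
  obtain a where a: "\<And>i j. a i j \<in> carrier R" "A = mat m n (\<lambda>(i, j). a i j)"
    using mats_obtain_fun[OF A] by blast
  obtain b where b: "\<And>i j. b i j \<in> carrier R" "B = mat n l (\<lambda>(i, j). b i j)"
    using mats_obtain_fun[OF B] by blast
  obtain c where c: "\<And>i j. c i j \<in> carrier R" "C = mat l h (\<lambda>(i, j). c i j)"
    using mats_obtain_fun[OF C] by blast
  have "(\<Oplus>k\<in>{..<l}. (\<Oplus>k'\<in>{..<n}. a i k' \<otimes> b k' k) \<otimes> c k j) =
      (\<Oplus>k'\<in>{..<n}. a i k' \<otimes> (\<Oplus>k\<in>{..<l}. b k' k \<otimes> c k j))" (is "?L = ?R") for i j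
  proof -
    have "?L = (\<Oplus>k\<in>{..<l}. \<Oplus>k'\<in>{..<n}. a i k' \<otimes> b k' k \<otimes> c k j)"
      using a b c by (intro finsum_cong' finsum_ldistr refl) (auto intro!: finsum_closed)
    also have "\<dots> = (\<Oplus>k'\<in>{..<n}. \<Oplus>k\<in>{..<l}. a i k' \<otimes> (b k' k \<otimes> c k j))"
      using a b c by (subst finsum_swap) (auto simp: m_assoc)
    also have "\<dots> = ?R"
      using a b c by (intro finsum_cong' finsum_rdistr[symmetric] refl) (auto intro!: finsum_closed)
    finally show ?thesis .
  qed
  then show ?thesis
    unfolding a(2) b(2) c(2) by (simp add: mmult_mat a(1) b(1) c(1) finsum_closed)
qed

lemma mone_idf: "mone R n = mat n n (\<lambda>(a, b). idf R a b)"
  unfolding mone_def idf_def ..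

lemma mone_in_mats: "mone R n \<in> mats R n n"
  unfolding mone_idf by (rule mat_in_mats[OF idf_closed])

lemma mone_mmult:
  assumes "A \<in> mats R m n"
  shows "mmult R (mone R m) A = A"
proof -
  obtain a where a: "\<And>i j. a i j \<in> carrier R" "A = mat m n (\<lambda>(i, j). a i j)"
    using mats_obtain_fun[OF assms] by blast
  show ?thesis unfolding a(2) mone_idf mmult_mat[OF idf_closed a(1)]
    by (rule eq_matI) (simp_all add: finsum_idf a(1))
qed

lemma mmult_mone:
  assumes "A \<in> mats R m n"
  shows "mmult R A (mone R n) = A"
proof -
  obtain a where a: "\<And>i j. a i j \<in> carrier R" "A = mat m n (\<lambda>(i, j). a i j)"
    using mats_obtain_fun[OF assms] by blast
  have "(\<Oplus>k\<in>{..<n}. a i k \<otimes> idf R k j) = a i j" if "j < n" for i j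
    using finsum_idf[OF that, of "a i"] a(1) by (simp add: idf_commute[of j] m_comm idf_closed)
  then show ?thesis unfolding a(2) mone_idf mmult_mat[OF a(1) idf_closed]
    by (intro eq_matI) simp_all
qed

lemma GL_mult:
  assumes "P \<in> GL R m" "Q \<in> GL R m"
  shows "mmult R P Q \<in> GL R m"
proof -
  obtain P' Q' where P: "P \<in> mats R m m" "P' \<in> mats R m m" "mmult R P P' = mone R m" "mmult R P' P = mone R m"
    and Q: "Q \<in> mats R m m" "Q' \<in> mats R m m" "mmult R Q Q' = mone R m" "mmult R Q' Q = mone R m"
    using assms unfolding GL_def by auto
  \<comment> \<open>Stated for arbitrary factors, since it serves both orders of the product of
    \<open>P Q\<close> with its inverse \<open>Q' P'\<close>.\<close>
  have cancel: "mmult R (mmult R A B) (mmult R B' A') = mone R m"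
    if "A \<in> mats R m m" "B \<in> mats R m m" "A' \<in> mats R m m" "B' \<in> mats R m m"
      "mmult R B B' = mone R m" "mmult R A A' = mone R m" for A B A' B'
  proof -
    have "mmult R (mmult R A B) (mmult R B' A') = mmult R A (mmult R B (mmult R B' A'))"
      using that mmult_assoc mmult_in_mats by blast
    also have "mmult R B (mmult R B' A') = mmult R (mmult R B B') A'"
      using that mmult_assoc by metis
    finally show ?thesis using that by (simp add: mone_mmult)
  qed
  show ?thesis unfolding GL_def
    using cancel[OF P(1) Q(1) P(2) Q(2) Q(3) P(3)] cancel[OF Q(2) P(2) Q(1) P(1) P(4) Q(4)]
      mmult_in_mats[OF P(1) Q(1)] mmult_in_mats[OF Q(2) P(2)] by blast
qed

lemma mone_GL: "mone R n \<in> GL R n"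
  unfolding GL_def using mone_in_mats mone_mmult[OF mone_in_mats] by blast

section \<open>Operations as multiplication by invertible matrices\<close>

lemma mmult_rowop:
  assumes "i < m" "j < m" "i \<noteq> j" and f: "\<And>a b. f a b \<in> carrier R"
    and c: "p \<in> carrier R" "q \<in> carrier R" "r \<in> carrier R" "s \<in> carrier R"
  shows "mmult R (mat m m (\<lambda>(a, b). rowop R i j p q r s (idf R) a b)) (mat m n (\<lambda>(a, b). f a b)) =
    mat m n (\<lambda>(a, b). rowop R i j p q r s f a b)"
proof (rule eq_matI, simp_all add: mmult_def)
  fix a b assume ab: "a < m" "b < n"
  have "(\<Oplus>k\<in>{..<m}. mat m m (\<lambda>(a, b). rowop R i j p q r s (idf R) a b) $$ (a, k) \<otimes> mat m n (\<lambda>(a, b). f a b) $$ (k, b)) =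
      (\<Oplus>k\<in>{..<m}. rowop R i j p q r s (idf R) a k \<otimes> f k b)"
    using ab f c by (intro finsum_cong') (auto intro!: rowop_closed idf_closed)
  also have "\<dots> = rowop R i j p q r s f a b"
    using assms ab finsum_idf2[where f = "\<lambda>k. f k b"] finsum_idf[where f = "\<lambda>k. f k b"]
    unfolding rowop_def by simp
  finally show "(\<Oplus>k\<in>{..<m}. mat m m (\<lambda>(a, b). rowop R i j p q r s (idf R) a b) $$ (a, k) \<otimes> mat m n (\<lambda>(a, b). f a b) $$ (k, b)) =
      rowop R i j p q r s f a b" .
qed

lemma mmult_colop:
  assumes "i < n" "j < n" "i \<noteq> j" and f: "\<And>a b. f a b \<in> carrier R"
    and c: "p \<in> carrier R" "q \<in> carrier R" "r \<in> carrier R" "s \<in> carrier R"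
  shows "mmult R (mat m n (\<lambda>(a, b). f a b)) (mat n n (\<lambda>(a, b). colop R i j p q r s (idf R) a b)) =
    mat m n (\<lambda>(a, b). colop R i j p q r s f a b)"
proof -
  \<comment> \<open>Over a commutative ring transposition reverses products, which reduces the claim
    to row operations.\<close>
  have tr: "mmult R (mat m n (\<lambda>(a, b). f a b)) (mat n n (\<lambda>(a, b). g b a)) =
      mat m n (\<lambda>(a, b). mmult R (mat n n (\<lambda>(a, b). g a b)) (mat n m (\<lambda>(a, b). f b a)) $$ (b, a))"
    if g: "\<And>a b. g a b \<in> carrier R" for g
    unfolding mmult_def using f g by (auto intro!: eq_matI finsum_cong' simp: m_comm)
  have "colop R i j p q r s (idf R) a b = rowop R i j p q r s (idf R) b a" for a b
    unfolding colop_def rowop_def by (simp add: idf_commute)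
  then show ?thesis
    using tr[of "rowop R i j p q r s (idf R)"] mmult_rowop[OF assms(1-3) _ c, of "\<lambda>a b. f b a" m] f c
    by (simp add: rowop_closed idf_closed) (auto simp: colop_def)
qed

lemma rowop_GL:
  assumes "i < m" "j < m" "i \<noteq> j" and inv: "inverse2 R p q r s p' q' r' s'"
  shows "mat m m (\<lambda>(a, b). rowop R i j p q r s (idf R) a b) \<in> GL R m"
proof -
  note c = inverse2_closed[OF inv] and c' = inverse2_closed[OF inverse2_sym[OF inv]]
  have "rowop R i j p q r s (rowop R i j p' q' r' s' (idf R)) = idf R"
    "rowop R i j p' q' r' s' (rowop R i j p q r s (idf R)) = idf R"
    using rowop_inverse inv inverse2_sym[OF inv] assms(3) idf_closed by blast+
  moreover have "rowop R i j p q r s (idf R) a b \<in> carrier R" "rowop R i j p' q' r' s' (idf R) a b \<in> carrier R" for a b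
    by (intro rowop_closed idf_closed c c')+
  ultimately show ?thesis unfolding GL_def mone_idf
    using mmult_rowop[OF assms(1-3), where n = m and f = "rowop R i j p' q' r' s' (idf R)", OF _ c]
      mmult_rowop[OF assms(1-3), where n = m and f = "rowop R i j p q r s (idf R)", OF _ c']
      mat_in_mats[where f = "rowop R i j p q r s (idf R)"] mat_in_mats[where f = "rowop R i j p' q' r' s' (idf R)"]
    by (auto intro!: bexI[of _ "mat m m (\<lambda>(a, b). rowop R i j p' q' r' s' (idf R) a b)"])
qed

lemma colop_GL:
  assumes "i < m" "j < m" "i \<noteq> j" and inv: "inverse2 R p q r s p' q' r' s'"
  shows "mat m m (\<lambda>(a, b). colop R i j p q r s (idf R) a b) \<in> GL R m"
proof -
  note c = inverse2_closed[OF inv] and c' = inverse2_closed[OF inverse2_sym[OF inv]]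
  have cl: "colop R i j p q r s (idf R) a b \<in> carrier R" "colop R i j p' q' r' s' (idf R) a b \<in> carrier R" for a b
    unfolding colop_def by (intro rowop_closed idf_closed c c')+
  have "colop R i j p q r s (colop R i j p' q' r' s' (idf R)) = idf R"
    "colop R i j p' q' r' s' (colop R i j p q r s (idf R)) = idf R"
    using colop_inverse inv inverse2_sym[OF inv] assms(3) idf_closed by blast+
  then show ?thesis unfolding GL_def mone_idf
    using mmult_colop[OF assms(1-3), where m = m and f = "colop R i j p' q' r' s' (idf R)", OF cl(2) c]
      mmult_colop[OF assms(1-3), where m = m and f = "colop R i j p q r s (idf R)", OF cl(1) c']
      mat_in_mats[where f = "colop R i j p q r s (idf R)", OF cl(1)]
      mat_in_mats[where f = "colop R i j p' q' r' s' (idf R)", OF cl(2)]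
    by (auto intro!: bexI[of _ "mat m m (\<lambda>(a, b). colop R i j p' q' r' s' (idf R) a b)"])
qed

text \<open>From here on a matrix is a function \<^typ>\<open>nat \<Rightarrow> nat \<Rightarrow> 'a\<close> that vanishes outside the
  \<open>m \<times> n\<close> rectangle, which makes index bounds superfluous; \<open>k\<close> is the first row and column
  that the operations may touch.\<close>

inductive reach :: "nat \<Rightarrow> nat \<Rightarrow> nat \<Rightarrow> (nat \<Rightarrow> nat \<Rightarrow> 'a) \<Rightarrow> (nat \<Rightarrow> nat \<Rightarrow> 'a) \<Rightarrow> bool"
  for m n k f where
  refl: "reach m n k f f"
| row: "\<lbrakk>reach m n k f g; k \<le> i; k \<le> j; i < m; j < m; i \<noteq> j; inverse2 R p q r s p' q' r' s'\<rbrakk>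
    \<Longrightarrow> reach m n k f (rowop R i j p q r s g)"
| col: "\<lbrakk>reach m n k f g; k \<le> i; k \<le> j; i < n; j < n; i \<noteq> j; inverse2 R p q r s p' q' r' s'\<rbrakk>
    \<Longrightarrow> reach m n k f (colop R i j p q r s g)"

lemma reach_trans:
  assumes "reach m n k g h" "reach m n k f g"
  shows "reach m n k f h"
  using assms(1) by induction (auto intro: assms(2) row col)

lemma reach_mono:
  assumes "reach m n k f g" "k' \<le> k"
  shows "reach m n k' f g"
  using assms(1)
proof induction
  case refl
  then show ?case by (rule reach.refl)
next
  case (row g i j p q r s p' q' r' s')
  then show ?case using assms(2) by (intro reach.row[of m n k' f g i j p q r s p' q' r' s']) auto
next
  case (col g i j p q r s p' q' r' s')
  then show ?case using assms(2) by (intro reach.col[of m n k' f g i j p q r s p' q' r' s']) auto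
qed

definition supported :: "nat \<Rightarrow> nat \<Rightarrow> (nat \<Rightarrow> nat \<Rightarrow> 'a) \<Rightarrow> bool" where
  "supported m n f \<longleftrightarrow> (\<forall>a b. f a b \<in> carrier R) \<and> (\<forall>a b. m \<le> a \<or> n \<le> b \<longrightarrow> f a b = \<zero>)"

lemma supported_rowop:
  assumes "supported m n f" "i < m" "j < m" "inverse2 R p q r s p' q' r' s'"
  shows "supported m n (rowop R i j p q r s f)"
  using assms inverse2_closed[OF assms(4)] unfolding supported_def rowop_def by auto

lemma supported_colop:
  assumes "supported m n f" "i < n" "j < n" "inverse2 R p q r s p' q' r' s'"
  shows "supported m n (colop R i j p q r s f)"
  using assms inverse2_closed[OF assms(4)] unfolding supported_def colop_def rowop_def by auto

lemma reach_supported: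
  assumes "reach m n k f g" "supported m n f"
  shows "supported m n g"
  using assms(1) by induction (auto intro: assms(2) supported_rowop supported_colop)

text \<open>Each row operation contributes an invertible factor on the left of \<open>P\<close>,
  each column operation one on the right of \<open>Q\<close>.\<close>

lemma reach_equivalent:
  assumes "reach m n k f g" "supported m n f"
  shows "\<exists>P\<in>GL R m. \<exists>Q\<in>GL R n.
    mat m n (\<lambda>(a, b). g a b) = mmult R (mmult R P (mat m n (\<lambda>(a, b). f a b))) Q"
  using assms(1)
proof induction
  case refl
  have "mat m n (\<lambda>(a, b). f a b) \<in> mats R m n"
    using assms(2) unfolding supported_def by (auto intro: mat_in_mats)
  then show ?case using mone_GL mone_mmult mmult_mone by metis
next
  case (row g i j p q r s p' q' r' s')
  let ?F = "mat m n (\<lambda>(a, b). f a b)"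
  let ?E = "mat m m (\<lambda>(a, b). rowop R i j p q r s (idf R) a b)"
  obtain P Q where P: "P \<in> GL R m" and Q: "Q \<in> GL R n"
    and eq: "mat m n (\<lambda>(a, b). g a b) = mmult R (mmult R P ?F) Q"
    using row.IH by blast
  have E: "?E \<in> GL R m" using row by (intro rowop_GL)
  have F: "?F \<in> mats R m n" using assms(2) unfolding supported_def by (auto intro: mat_in_mats)
  have mats: "P \<in> mats R m m" "Q \<in> mats R n n" "?E \<in> mats R m m"
    using P Q E unfolding GL_def by auto
  have g: "g a b \<in> carrier R" for a b
    using reach_supported[OF row.hyps(1) assms(2)] unfolding supported_def by blast
  have "mat m n (\<lambda>(a, b). rowop R i j p q r s g a b) = mmult R ?E (mmult R (mmult R P ?F) Q)"
    using mmult_rowop[OF row.hyps(4-6), where f = g and n = n, OF g inverse2_closed[OF row.hyps(7)]] eq by simp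
  also have "\<dots> = mmult R (mmult R ?E (mmult R P ?F)) Q"
    by (rule mmult_assoc[OF mats(3) mmult_in_mats[OF mats(1) F] mats(2), symmetric])
  also have "mmult R ?E (mmult R P ?F) = mmult R (mmult R ?E P) ?F"
    by (rule mmult_assoc[OF mats(3,1) F, symmetric])
  finally show ?case using GL_mult[OF E P] Q by blast
next
  case (col g i j p q r s p' q' r' s')
  let ?F = "mat m n (\<lambda>(a, b). f a b)"
  let ?E = "mat n n (\<lambda>(a, b). colop R i j p q r s (idf R) a b)"
  obtain P Q where P: "P \<in> GL R m" and Q: "Q \<in> GL R n"
    and eq: "mat m n (\<lambda>(a, b). g a b) = mmult R (mmult R P ?F) Q"
    using col.IH by blast
  have E: "?E \<in> GL R n" using col by (intro colop_GL)
  have F: "?F \<in> mats R m n" using assms(2) unfolding supported_def by (auto intro: mat_in_mats)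
  have mats: "P \<in> mats R m m" "Q \<in> mats R n n" "?E \<in> mats R n n"
    using P Q E unfolding GL_def by auto
  have g: "g a b \<in> carrier R" for a b
    using reach_supported[OF col.hyps(1) assms(2)] unfolding supported_def by blast
  have "mat m n (\<lambda>(a, b). colop R i j p q r s g a b) = mmult R (mmult R (mmult R P ?F) Q) ?E"
    using mmult_colop[OF col.hyps(4-6), where f = g and m = m, OF g inverse2_closed[OF col.hyps(7)]] eq by simp
  also have "\<dots> = mmult R (mmult R P ?F) (mmult R Q ?E)"
    by (rule mmult_assoc[OF mmult_in_mats[OF mats(1) F] mats(2,3)])
  finally show ?case using GL_mult[OF Q E] P by blast
qed

subsection \<open>Diagonal reduction over Hermite rings\<close>

lemma mmult_entry:
  assumes "A \<in> mats R m n" "B \<in> mats R n l" "i < m" "j < l"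
  shows "mmult R A B $$ (i, j) = (\<Oplus>k\<in>{..<n}. A $$ (i, k) \<otimes> B $$ (k, j))"
  using assms unfolding mmult_def mats_iff by auto

text \<open>Reduce the row \<open>A = (x, y)\<close> to \<open>P A Q = (d, 0)\<close>. Cancelling
  \<open>P\<close> gives \<open>A Q = (g, 0)\<close>, so \<open>A\<close> is \<open>g\<close> times
  the first row of the inverse \<open>Q'\<close> of \<open>Q\<close>.\<close>

lemma hermite_pair:
  assumes H: "hermite_ring R" and x: "x \<in> carrier R" and y: "y \<in> carrier R"
  shows "\<exists>g\<in>carrier R. \<exists>s\<in>carrier R. \<exists>t\<in>carrier R. \<exists>u\<in>carrier R. \<exists>v\<in>carrier R.
    x = g \<otimes> s \<and> y = g \<otimes> t \<and> s \<otimes> u \<oplus> t \<otimes> v = \<one>"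
proof -
  define A where "A = mat 1 2 (\<lambda>(i, j). if j = (0::nat) then x else y)"
  have A: "A \<in> mats R 1 2" using x y unfolding A_def mats_iff by auto
  have "admits_diagonal_reduction R 1 2 A"
    using H A unfolding hermite_ring_def by (rule bspec)
  then obtain P Q D where PQ: "P \<in> GL R 1" "Q \<in> GL R 2" and D: "D = mmult R (mmult R P A) Q"
    and "\<forall>i<1. \<forall>j<2. i \<noteq> j \<longrightarrow> D $$ (i, j) = \<zero>"
    unfolding admits_diagonal_reduction_def by (elim bexE exE conjE)
  then have D0: "D $$ (0, 1) = \<zero>" by simp
  obtain P' where P: "P \<in> mats R 1 1" "P' \<in> mats R 1 1" "mmult R P' P = mone R 1"
    using PQ(1) unfolding GL_def by auto
  obtain Q' where Q: "Q \<in> mats R 2 2" "Q' \<in> mats R 2 2" "mmult R Q Q' = mone R 2" "mmult R Q' Q = mone R 2"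
    using PQ(2) unfolding GL_def by auto
  define AQ where "AQ = mmult R A Q"
  have AQ: "AQ \<in> mats R 1 2" unfolding AQ_def by (rule mmult_in_mats[OF A Q(1)])
  have "mmult R P' D = mmult R P' (mmult R P AQ)"
    by (simp only: D mmult_assoc[OF P(1) A Q(1)] AQ_def)
  also have "\<dots> = AQ"
    by (simp only: mmult_assoc[OF P(2,1) AQ, symmetric] P(3) mone_mmult[OF AQ])
  finally have AQ_eq: "AQ = mmult R P' D" by (rule sym)
  have D_mat: "D \<in> mats R 1 2"
    unfolding D by (rule mmult_in_mats[OF mmult_in_mats[OF P(1) A] Q(1)])
  have "AQ $$ (0, 1) = P' $$ (0, 0) \<otimes> D $$ (0, 1)"
    unfolding AQ_eq by (subst mmult_entry[OF P(2) D_mat])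
      (use P(2) D_mat in \<open>simp_all add: lessThan_Suc mats_iff\<close>)
  then have AQ1: "AQ $$ (0, 1) = \<zero>" using D0 P(2) unfolding mats_iff by simp
  define g where "g = AQ $$ (0, 0)"
  have g: "g \<in> carrier R" using AQ unfolding g_def mats_iff by simp
  have cQ: "Q $$ (i, j) \<in> carrier R" "Q' $$ (i, j) \<in> carrier R" if "i < 2" "j < 2" for i j
    using Q that unfolding mats_iff by auto
  have two: "(\<Oplus>k\<in>{..<2::nat}. f k) = f 1 \<oplus> f 0" if "f 0 \<in> carrier R" "f 1 \<in> carrier R" for f
    using that by (simp add: numeral_2_eq_2 lessThan_Suc)
  have "mmult R AQ Q' = A"
    by (simp only: AQ_def mmult_assoc[OF A Q(1,2)] Q(3) mmult_mone[OF A])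
  then have AQQ': "mmult R AQ Q' $$ (0, j) = A $$ (0, j)" for j by (rule arg_cong)
  have A_eq: "A $$ (0, j) = g \<otimes> Q' $$ (0, j)" if "j < 2" for j
  proof -
    have "A $$ (0, j) = (\<Oplus>k\<in>{..<2}. AQ $$ (0, k) \<otimes> Q' $$ (k, j))"
      by (rule trans[OF AQQ'[symmetric] mmult_entry[OF AQ Q(2) _ that]]) simp
    also have "\<dots> = AQ $$ (0, 1) \<otimes> Q' $$ (1, j) \<oplus> AQ $$ (0, 0) \<otimes> Q' $$ (0, j)"
      by (rule two; unfold AQ1 g_def[symmetric]) (use cQ g that in simp_all)
    also have "\<dots> = g \<otimes> Q' $$ (0, j)"
      unfolding AQ1 g_def[symmetric] using cQ that g by simp
    finally show ?thesis .
  qed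
  \<comment> \<open>The corner entry of \<open>Q' Q = 1\<close> shows that the first row of
    \<open>Q'\<close> is unimodular.\<close>
  have "Q' $$ (0, 0) \<otimes> Q $$ (0, 0) \<oplus> Q' $$ (0, 1) \<otimes> Q $$ (1, 0) = \<one>"
    using mmult_entry[OF Q(2,1), of 0 0] cQ unfolding Q(4)
    by (simp add: two mone_def a_comm)
  moreover have "x = g \<otimes> Q' $$ (0, 0)" "y = g \<otimes> Q' $$ (0, 1)"
    using A_eq[of 0] A_eq[of 1] unfolding A_def by simp_all
  moreover have "Q' $$ (0, 0) \<in> carrier R" "Q' $$ (0, 1) \<in> carrier R" "Q $$ (0, 0) \<in> carrier R" "Q $$ (1, 0) \<in> carrier R"
    using cQ by simp_all
  ultimately show ?thesis using g by (intro bexI[of _ g] bexI[of _ "Q' $$ (0, 0)"] bexI[of _ "Q' $$ (0, 1)"]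
      bexI[of _ "Q $$ (0, 0)"] bexI[of _ "Q $$ (1, 0)"] conjI)
qed

text \<open>With \<open>x = g s\<close> and \<open>y = g t\<close>, the row \<open>(-t, s)\<close>
  annihilates \<open>(x, y)\<close>; Bezout coefficients of \<open>s, t\<close> complete it to an
  invertible block.\<close>

lemma hermite_op:
  assumes H: "hermite_ring R" and x: "x \<in> carrier R" and y: "y \<in> carrier R"
  shows "\<exists>p q r s p' q' r' s'. inverse2 R p q r s p' q' r' s' \<and> r \<otimes> x \<oplus> s \<otimes> y = \<zero>"
proof -
  obtain g s t u v where c: "g \<in> carrier R" "s \<in> carrier R" "t \<in> carrier R" "u \<in> carrier R" "v \<in> carrier R"
    and eq: "x = g \<otimes> s" "y = g \<otimes> t" "s \<otimes> u \<oplus> t \<otimes> v = \<one>"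
    using hermite_pair[OF assms] by blast
  have ts: "t \<otimes> (g \<otimes> s) = s \<otimes> (g \<otimes> t)" using c by (simp add: m_ac)
  have "u \<otimes> s \<oplus> v \<otimes> t = \<one>" using eq(3) c m_comm by simp
  then have "inverse2 R u v (\<ominus> t) s s (\<ominus> v) t u"
    using inverse2_unimodular c by blast
  moreover have "\<ominus> t \<otimes> x \<oplus> s \<otimes> y = \<zero>"
    unfolding eq(1,2) using c by (simp add: l_minus ts l_neg)
  ultimately show ?thesis by blast
qed

section \<open>Divisibility of entries under operations\<close>

lemma divides_comb:
  assumes "d divides x" "d divides y" "d \<in> carrier R" "p \<in> carrier R" "q \<in> carrier R"
  shows "d divides (p \<otimes> x \<oplus> q \<otimes> y)"
proof -
  obtain e f where e: "e \<in> carrier R" "x = d \<otimes> e" "f \<in> carrier R" "y = d \<otimes> f"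
    using assms(1,2) unfolding factor_def by blast
  have "p \<otimes> x \<oplus> q \<otimes> y = d \<otimes> (p \<otimes> e \<oplus> q \<otimes> f)"
    using e assms by (simp add: r_distr m_lcomm)
  then show ?thesis unfolding factor_def using e assms by auto
qed

lemma divides_zero: "d \<in> carrier R \<Longrightarrow> d divides \<zero>"
  unfolding factor_def by (auto intro!: bexI[of _ "\<zero>"])

lemma zero_divides: "\<zero> divides x \<longleftrightarrow> x = \<zero>"
  unfolding factor_def by auto

text \<open>A new entry is a combination of old entries of the same column, and
  \<open>c \<le> i\<close>, \<open>c \<le> j\<close> keep those within the range where
  \<open>d\<close> divides.\<close>

lemma rowop_divides:
  assumes "inverse2 R p q r s p' q' r' s'" "d \<in> carrier R" "c \<le> i" "c \<le> j"
    and "\<And>a. c \<le> a \<Longrightarrow> d divides f a b" "c \<le> a"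
  shows "d divides rowop R i j p q r s f a b"
  using assms inverse2_closed[OF assms(1)] unfolding rowop_def by (auto intro!: divides_comb)

lemma colop_divides:
  assumes "inverse2 R p q r s p' q' r' s'" "d \<in> carrier R" "c \<le> i" "c \<le> j"
    and "\<And>b. c \<le> b \<Longrightarrow> d divides f a b" "c \<le> b"
  shows "d divides colop R i j p q r s f a b"
  unfolding colop_def using assms by (intro rowop_divides)

text \<open>Taking \<open>d = \<zero>\<close> in the last clause shows that rows which vanish from column \<open>c\<close> on still do.\<close>

lemma clear_row:
  assumes H: "hermite_ring R" and f: "supported m n f" and c: "k \<le> c"
  shows "\<exists>g. reach m n k f g \<and> (\<forall>b>c. g i b = \<zero>) \<and> (\<forall>a. \<forall>b<c. g a b = f a b) \<and>
    (\<forall>a. \<forall>d\<in>carrier R. (\<forall>b\<ge>c. d divides g a b) \<longleftrightarrow> (\<forall>b\<ge>c. d divides f a b))"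
proof -
  \<comment> \<open>Induction on the number \<open>t\<close> of columns to the right of
    \<open>c\<close> that have been cleared in row \<open>i\<close>.\<close>
  have "\<exists>g. reach m n k f g \<and> (\<forall>b>c. b \<le> c + t \<longrightarrow> g i b = \<zero>) \<and> (\<forall>a. \<forall>b<c. g a b = f a b) \<and>
    (\<forall>a. \<forall>d\<in>carrier R. (\<forall>b\<ge>c. d divides g a b) \<longleftrightarrow> (\<forall>b\<ge>c. d divides f a b))" for t
  proof (induction t)
    case 0
    then show ?case by (intro exI[of _ f]) (auto intro: reach.refl)
  next
    case (Suc t)
    obtain g where reach: "reach m n k f g" and clear: "\<forall>b>c. b \<le> c + t \<longrightarrow> g i b = \<zero>"
      and same: "\<forall>a. \<forall>b<c. g a b = f a b"
      and iff: "\<forall>a. \<forall>d\<in>carrier R. (\<forall>b\<ge>c. d divides g a b) \<longleftrightarrow> (\<forall>b\<ge>c. d divides f a b)"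
      using Suc.IH by (elim exE conjE)
    let ?b = "c + Suc t"
    have sg: "supported m n g" by (rule reach_supported[OF reach f])
    then have cg: "g a b \<in> carrier R" for a b unfolding supported_def by blast
    show ?case
    proof (cases "?b < n")
      case False
      then have "g i ?b = \<zero>" using sg unfolding supported_def by simp
      then have "\<forall>b>c. b \<le> ?b \<longrightarrow> g i b = \<zero>" using clear le_Suc_eq by auto
      then show ?thesis using reach same iff by (intro exI[of _ g] conjI)
    next
      case True
      obtain p q r s p' q' r' s' where inv: "inverse2 R p q r s p' q' r' s'"
        and zero: "r \<otimes> g i c \<oplus> s \<otimes> g i ?b = \<zero>"
        using hermite_op[OF H cg cg] by blast
      \<comment> \<open>Mixing columns \<open>c\<close> and \<open>?b\<close> kills the entry in
        column \<open>?b\<close>, and leaves the columns cleared before as they are.\<close>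
      define h where "h = colop R c ?b p q r s g"
      \<comment> \<open>Undoing the operation yields the converse direction of the divisibility
        equivalence.\<close>
      have h_inv: "colop R c ?b p' q' r' s' h = g"
        unfolding h_def using colop_inverse[OF inverse2_sym[OF inv]] cg by simp
      have "reach m n k f h"
        unfolding h_def by (rule reach.col[OF reach _ _ _ _ _ inv]) (use c True in auto)
      moreover have "\<forall>b>c. b \<le> ?b \<longrightarrow> h i b = \<zero>"
        using clear zero unfolding h_def colop_def rowop_def by auto
      moreover have "\<forall>a. \<forall>b<c. h a b = f a b"
        using same unfolding h_def colop_def rowop_def by auto
      moreover have "\<forall>a. \<forall>d\<in>carrier R. (\<forall>b\<ge>c. d divides h a b) \<longleftrightarrow> (\<forall>b\<ge>c. d divides f a b)"
      proof (intro allI ballI)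
        fix a d assume d: "d \<in> carrier R"
        have "\<forall>b\<ge>c. d divides g a b" if "\<forall>b\<ge>c. d divides h a b"
          using colop_divides[OF inverse2_sym[OF inv] d, of c c ?b h a] that unfolding h_inv by simp
        moreover have "\<forall>b\<ge>c. d divides h a b" if "\<forall>b\<ge>c. d divides g a b"
          unfolding h_def using colop_divides[OF inv d, of c c ?b g a] that by simp
        ultimately show "(\<forall>b\<ge>c. d divides h a b) \<longleftrightarrow> (\<forall>b\<ge>c. d divides f a b)"
          using iff d by blast
      qed
      ultimately show ?thesis by (intro exI[of _ h] conjI)
    qed
  qed
  \<comment> \<open>Taking \<open>t = n\<close> suffices: columns beyond \<open>c + n\<close> lie
    outside the support.\<close>
  from this[of n] obtain g where reach: "reach m n k f g" and clear: "\<forall>b>c. b \<le> c + n \<longrightarrow> g i b = \<zero>"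
      and same: "\<forall>a. \<forall>b<c. g a b = f a b"
      and iff: "\<forall>a. \<forall>d\<in>carrier R. (\<forall>b\<ge>c. d divides g a b) \<longleftrightarrow> (\<forall>b\<ge>c. d divides f a b)"
    by (elim exE conjE)
  have "\<forall>b>c. g i b = \<zero>"
  proof (intro allI impI)
    fix b assume "c < b"
    then show "g i b = \<zero>"
      using clear reach_supported[OF reach f] unfolding supported_def by (cases "b \<le> c + n") auto
  qed
  then show ?thesis using reach same iff by (intro exI[of _ g] conjI)
qed

section \<open>Moving a common divisor into the corner\<close>

text \<open>After clearing, \<open>g i c\<close> divides all of its row from column \<open>c\<close>
  on. The equivalence in \<open>clear_row\<close> takes this back to \<open>f i c\<close>, hence to
  all entries that \<open>f i c\<close> divides, and then forward to \<open>g\<close>.\<close>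

lemma make_row_generator:
  assumes H: "hermite_ring R" and f: "supported m n f" and c: "k \<le> c"
    and dv: "\<forall>a\<ge>i. \<forall>b\<ge>c. f i c divides f a b"
  shows "\<exists>g. reach m n k f g \<and> (\<forall>b>c. g i b = \<zero>) \<and> (\<forall>a\<ge>i. \<forall>b\<ge>c. g i c divides g a b)"
proof -
  obtain g where g: "reach m n k f g" "\<forall>b>c. g i b = \<zero>" and same: "\<forall>a. \<forall>b<c. g a b = f a b"
    and iff: "\<forall>a. \<forall>d\<in>carrier R. (\<forall>b\<ge>c. d divides g a b) \<longleftrightarrow> (\<forall>b\<ge>c. d divides f a b)"
    using clear_row[OF H f c, of i] by (elim exE conjE)
  have cl: "f a b \<in> carrier R" "g a b \<in> carrier R" for a b
    using f reach_supported[OF g(1) f] unfolding supported_def by auto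
  have "\<forall>b\<ge>c. g i c divides g i b"
    using g(2) cl by (metis divides_zero divides_refl le_neq_implies_less)
  then have "g i c divides f i c" using iff cl by blast
  then have "\<forall>b\<ge>c. g i c divides f a b" if "a \<ge> i" for a
    using dv that cl divides_trans by metis
  then have "\<forall>a\<ge>i. \<forall>b\<ge>c. g i c divides g a b"
    using iff cl by metis
  then show ?thesis using g by (intro exI[of _ g] conjI)
qed

text \<open>Two Hermite factorizations extract the gcd \<open>h\<close> of the block
  \<open>[[x, y], [z, 0]]\<close> and leave unimodular cofactors. By \<open>asr1_unimodular\<close>
  some row combination \<open>(p, q)\<close> equals \<open>h (e, f)\<close> with
  \<open>(e, f)\<close> unimodular, so that the column combination \<open>(s, t)\<close> returns
  \<open>h\<close>.\<close>

lemma two_by_two_generator: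
  assumes H: "hermite_ring R" and asr: "almost_stable_range_1 R"
    and c: "x \<in> carrier R" "y \<in> carrier R" "z \<in> carrier R"
  obtains h p q u v e f s t
  where "{h, p, q, u, v, e, f, s, t} \<subseteq> carrier R"
    "p \<otimes> u \<oplus> q \<otimes> v = \<one>" "s \<otimes> e \<oplus> t \<otimes> f = \<one>"
    "h divides x" "h divides y" "h divides z"
    "p \<otimes> x \<oplus> q \<otimes> z = h \<otimes> e" "p \<otimes> y = h \<otimes> f"
proof -
  obtain r x' y' a b where r: "r \<in> carrier R" "x' \<in> carrier R" "y' \<in> carrier R" "a \<in> carrier R" "b \<in> carrier R"
    and xy: "x = r \<otimes> x'" "y = r \<otimes> y'" and ab: "x' \<otimes> a \<oplus> y' \<otimes> b = \<one>"
    using hermite_pair[OF H c(1,2)] by (elim bexE conjE)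
  obtain h r' z' k l where h: "h \<in> carrier R" "r' \<in> carrier R" "z' \<in> carrier R" "k \<in> carrier R" "l \<in> carrier R"
    and rz: "r = h \<otimes> r'" "z = h \<otimes> z'" and kl: "r' \<otimes> k \<oplus> z' \<otimes> l = \<one>"
    using hermite_pair[OF H r(1) c(3)] by (elim bexE conjE)
  \<comment> \<open>Substitute the relation for \<open>x', y'\<close> into the one for
    \<open>r', z'\<close>.\<close>
  have "r' \<otimes> y' \<otimes> (b \<otimes> k) \<oplus> (r' \<otimes> x' \<otimes> (a \<otimes> k) \<oplus> z' \<otimes> l) = r' \<otimes> k \<otimes> (x' \<otimes> a \<oplus> y' \<otimes> b) \<oplus> z' \<otimes> l"
    using r h by (simp add: r_distr m_ac a_ac)
  also have "\<dots> = \<one>" unfolding ab using h kl by simp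
  finally have unimodular: "r' \<otimes> y' \<otimes> (b \<otimes> k) \<oplus> (r' \<otimes> x' \<otimes> (a \<otimes> k) \<oplus> z' \<otimes> l) = \<one>" .
  obtain p q s t where p: "p \<in> carrier R" "q \<in> carrier R" "s \<in> carrier R" "t \<in> carrier R"
    and eq: "(p \<otimes> (r' \<otimes> x') \<oplus> q \<otimes> z') \<otimes> s \<oplus> (p \<otimes> (r' \<otimes> y')) \<otimes> t = \<one>"
    using asr1_unimodular[OF asr _ _ _ _ _ _ unimodular] r h m_closed by blast
  let ?e = "p \<otimes> (r' \<otimes> x') \<oplus> q \<otimes> z'" and ?f = "p \<otimes> (r' \<otimes> y')"
  \<comment> \<open>The coefficients of \<open>p\<close> and \<open>q\<close> in \<open>eq\<close>,
    which show that \<open>(p, q)\<close> is unimodular.\<close>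
  let ?u = "r' \<otimes> x' \<otimes> s \<oplus> r' \<otimes> y' \<otimes> t" and ?v = "z' \<otimes> s"
  show ?thesis
  proof (rule that)
    show "{h, p, q, ?u, ?v, ?e, ?f, s, t} \<subseteq> carrier R" using r h p by simp
    show "p \<otimes> ?u \<oplus> q \<otimes> ?v = \<one>"
      unfolding eq[symmetric] using r h p by (simp add: l_distr r_distr m_ac a_ac)
    show "s \<otimes> ?e \<oplus> t \<otimes> ?f = \<one>"
      unfolding eq[symmetric] using r h p by (simp add: m_comm[of s] m_comm[of t])
    have "x = h \<otimes> (r' \<otimes> x')" "y = h \<otimes> (r' \<otimes> y')" using xy rz r h by (simp_all add: m_assoc)
    then show "h divides x" "h divides y" "h divides z"
      unfolding factor_def using rz r h m_closed by blast+
    show "p \<otimes> x \<oplus> q \<otimes> z = h \<otimes> ?e" "p \<otimes> y = h \<otimes> ?f"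
      unfolding xy rz using r h p by (simp_all add: r_distr m_ac)
  qed
qed

text \<open>\<open>g1\<close> clears row \<open>Suc i\<close> after column \<open>k\<close>,
  \<open>g2\<close> clears row \<open>i\<close> after column \<open>Suc k\<close>, \<open>g3\<close>
  combines the two rows, and \<open>g4\<close> combines columns \<open>k\<close> and
  \<open>Suc k\<close>.\<close>

lemma generator_step:
  assumes H: "hermite_ring R" and asr: "almost_stable_range_1 R" and f: "supported m n f"
    and k: "k \<le> i" "Suc i < m" "k < n"
    and dv: "\<forall>a\<ge>Suc i. \<forall>b\<ge>k. f (Suc i) k divides f a b"
  shows "\<exists>g. reach m n k f g \<and> (\<forall>a\<ge>i. \<forall>b\<ge>k. g i k divides g a b)"
proof -
  obtain g1 where reach1: "reach m n k f g1" and zero1: "\<forall>b>k. g1 (Suc i) b = \<zero>"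
    and dv1: "\<forall>a\<ge>Suc i. \<forall>b\<ge>k. g1 (Suc i) k divides g1 a b"
    using make_row_generator[OF H f order_refl dv] by (elim exE conjE)
  have s1: "supported m n g1" by (rule reach_supported[OF reach1 f])
  \<comment> \<open>Clearing starts at column \<open>Suc k\<close>, so column \<open>k\<close>, with
    the generator \<open>z\<close>, stays intact.\<close>
  obtain g2 where reach12: "reach m n k g1 g2" and zero2: "\<forall>b>Suc k. g2 i b = \<zero>"
    and same: "\<forall>a. \<forall>b<Suc k. g2 a b = g1 a b"
    and iff: "\<forall>a. \<forall>d\<in>carrier R. (\<forall>b\<ge>Suc k. d divides g2 a b) \<longleftrightarrow> (\<forall>b\<ge>Suc k. d divides g1 a b)"
    using clear_row[where i = i and c = "Suc k" and k = k, OF H s1 le_SucI[OF order_refl]] by (elim exE conjE)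
  have reach2: "reach m n k f g2" by (rule reach_trans[OF reach12 reach1])
  have s2: "supported m n g2" by (rule reach_supported[OF reach2 f])
  then have c2: "g2 a b \<in> carrier R" for a b unfolding supported_def by blast
  have same_k: "g2 a k = g1 a k" for a using same by simp
  define z where "z = g2 (Suc i) k"
  have z: "z \<in> carrier R" unfolding z_def by (rule c2)
  have dv2: "z divides g2 a b" if "Suc i \<le> a" "k \<le> b" for a b
  proof (cases "b = k")
    case True
    then show ?thesis using dv1 that unfolding z_def same_k by (simp add: same_k)
  next
    case False
    have "\<forall>b\<ge>Suc k. z divides g1 a b" using dv1 that unfolding z_def same_k by simp
    then have "\<forall>b\<ge>Suc k. z divides g2 a b" using iff z by blast
    then show ?thesis using that False by simp
  qed
  have "\<forall>b\<ge>Suc k. \<zero> divides g2 (Suc i) b"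
  proof -
    have "\<forall>b\<ge>Suc k. \<zero> divides g1 (Suc i) b" using zero1 by (simp add: zero_divides)
    then show ?thesis using iff zero_closed by blast
  qed
  then have zero3: "g2 (Suc i) b = \<zero>" if "b > k" for b
    using that by (simp add: zero_divides)
  obtain h p q u v e e' s t where cl: "{h, p, q, u, v, e, e', s, t} \<subseteq> carrier R"
    and uni: "p \<otimes> u \<oplus> q \<otimes> v = \<one>" "s \<otimes> e \<oplus> t \<otimes> e' = \<one>"
    and hd: "h divides g2 i k" "h divides g2 i (Suc k)" "h divides z"
    and he: "p \<otimes> g2 i k \<oplus> q \<otimes> z = h \<otimes> e" "p \<otimes> g2 i (Suc k) = h \<otimes> e'"
    using two_by_two_generator[OF H asr c2 c2 z] .
  have h: "h \<in> carrier R" using cl by simp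
  have hdv2: "h divides g2 a b" if "i \<le> a" "k \<le> b" for a b
  proof (cases "a = i")
    case True
    then show ?thesis using hd zero2 that divides_zero[OF h]
      by (cases "b = k"; cases "b = Suc k") auto
  next
    case False
    then show ?thesis using divides_trans[OF hd(3) dv2 h] that by simp
  qed
  have inv: "inverse2 R p q (\<ominus> v) u u (\<ominus> q) v p"
    using inverse2_unimodular uni(1) cl by simp
  define g3 where "g3 = rowop R i (Suc i) p q (\<ominus> v) u g2"
  have reach3: "reach m n k f g3"
    unfolding g3_def by (rule reach.row[OF reach2 _ _ _ _ _ inv]) (use k in auto)
  have hdv3: "h divides g3 a b" if "i \<le> a" "k \<le> b" for a b
    unfolding g3_def by (rule rowop_divides[OF inv h, of i]) (use that hdv2 in auto)
  \<comment> \<open>Row \<open>Suc i\<close> vanishes in column \<open>Suc k\<close>, so only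
    \<open>p\<close> contributes to the second entry.\<close>
  have g3: "g3 i k = h \<otimes> e" "g3 i (Suc k) = h \<otimes> e'"
    using he zero3[of "Suc k"] cl c2 unfolding g3_def rowop_def z_def by simp_all
  have hef: "s \<otimes> (h \<otimes> e) \<oplus> t \<otimes> (h \<otimes> e') = h"
  proof -
    have "s \<otimes> (h \<otimes> e) \<oplus> t \<otimes> (h \<otimes> e') = h \<otimes> (s \<otimes> e \<oplus> t \<otimes> e')"
      using cl by (simp add: r_distr m_lcomm)
    then show ?thesis using h uni(2) by simp
  qed
  show ?thesis
  proof (cases "Suc k < n")
    case True
    have inv': "inverse2 R s t (\<ominus> e') e e (\<ominus> t) e' s"
      using inverse2_unimodular uni(2) cl by simp
    define g4 where "g4 = colop R k (Suc k) s t (\<ominus> e') e g3"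
    have "reach m n k f g4"
      unfolding g4_def by (rule reach.col[OF reach3 _ _ _ _ _ inv']) (use True in auto)
    moreover have "g4 i k = h"
      using hef g3 unfolding g4_def colop_def rowop_def by simp
    moreover have "h divides g4 a b" if "i \<le> a" "k \<le> b" for a b
      unfolding g4_def by (rule colop_divides[OF inv' h, of k]) (use that hdv3 in auto)
    ultimately show ?thesis by (intro exI[of _ g4]) simp
  next
    case False
    \<comment> \<open>There is no column \<open>Suc k\<close>, so \<open>h \<otimes> e' = \<zero>\<close> and \<open>h\<close> is associated to \<open>h \<otimes> e\<close>.\<close>
    then have "h \<otimes> e' = \<zero>"
      using s2 cl unfolding he(2)[symmetric] supported_def by simp
    then have "h = s \<otimes> (h \<otimes> e)" using hef cl by simp
    also have "\<dots> = (h \<otimes> e) \<otimes> s" using cl by (simp add: m_comm)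
    finally have "(h \<otimes> e) divides h" using cl unfolding factor_def by auto
    then have "g3 i k divides g3 a b" if "i \<le> a" "k \<le> b" for a b
      unfolding g3(1) using divides_trans[OF _ hdv3[OF that]] cl by simp
    then show ?thesis using reach3 by (intro exI[of _ g3]) simp
  qed
qed

text \<open>Induction upward through the rows, from the last one to row \<open>k\<close>. In the
  last row, clearing alone suffices, as everything below it is zero.\<close>

lemma submatrix_generator:
  assumes H: "hermite_ring R" and asr: "almost_stable_range_1 R" and f: "supported m n f"
    and k: "k < m" "k < n"
  shows "\<exists>g. reach m n k f g \<and> (\<forall>a\<ge>k. \<forall>b\<ge>k. g k k divides g a b)"
proof -
  have "\<exists>g. reach m n k f g \<and> (\<forall>a\<ge>i. \<forall>b\<ge>k. g i k divides g a b)" if "i \<le> m - 1" "k \<le> i" for i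
    using that
  proof (induction rule: inc_induct)
    case base
    obtain g where reach: "reach m n k f g" and zero: "\<forall>b>k. g (m - 1) b = \<zero>"
      using clear_row[where i = "m - 1" and c = k, OF H f order_refl] by (elim exE conjE)
    have s: "supported m n g" by (rule reach_supported[OF reach f])
    have cg: "g a b \<in> carrier R" for a b using s unfolding supported_def by blast
    have out: "g a b = \<zero>" if "m \<le> a" for a b using s that unfolding supported_def by blast
    have "g (m - 1) k divides g a b" if "m - 1 \<le> a" "k \<le> b" for a b
    proof (cases "a = m - 1 \<and> b = k")
      case True
      then show ?thesis using cg by simp
    next
      case False
      then have "g a b = \<zero>" using zero out[of a b] that by (cases "a = m - 1") auto
      then show ?thesis using cg divides_zero by simp
    qed
    then show ?case using reach by (intro exI[of _ g]) simp
  next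
    case (step i)
    obtain g where reach: "reach m n k f g" and dv: "\<forall>a\<ge>Suc i. \<forall>b\<ge>k. g (Suc i) k divides g a b"
      using step.IH[OF le_SucI[OF step.prems]] by (elim exE conjE)
    have Suc_i: "Suc i < m" using step.hyps by simp
    obtain h where h: "reach m n k g h" "\<forall>a\<ge>i. \<forall>b\<ge>k. h i k divides h a b"
      using generator_step[OF H asr reach_supported[OF reach f] step.prems Suc_i k(2) dv] by (elim exE conjE)
    show ?case using reach_trans[OF h(1) reach] h(2) by (intro exI[of _ h] conjI)
  qed
  from this[of k] k show ?thesis by simp
qed

text \<open>Each entry below the corner is a multiple of it, so subtracting multiples of row
  \<open>k\<close> clears the column and leaves row \<open>k\<close> itself unchanged.\<close>

lemma clear_column:
  assumes f: "supported m n f" and k: "k < m"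
    and zero: "\<forall>b>k. f k b = \<zero>" and dv: "\<forall>a\<ge>k. \<forall>b\<ge>k. f k k divides f a b"
  shows "\<exists>g. reach m n k f g \<and> (\<forall>a>k. g a k = \<zero>) \<and> (\<forall>b. g k b = f k b) \<and>
    (\<forall>a\<ge>k. \<forall>b\<ge>k. f k k divides g a b)"
proof -
  have cf: "f a b \<in> carrier R" for a b using f unfolding supported_def by blast
  have "\<exists>g. reach m n k f g \<and> (\<forall>a>k. a \<le> k + t \<longrightarrow> g a k = \<zero>) \<and> (\<forall>b. g k b = f k b) \<and>
    (\<forall>a\<ge>k. \<forall>b\<ge>k. f k k divides g a b)" for t
  proof (induction t)
    case 0
    then show ?case using dv by (intro exI[of _ f]) (auto intro: reach.refl)
  next
    case (Suc t)
    let ?a = "k + Suc t"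
    obtain g where reach: "reach m n k f g" and clear: "\<forall>a>k. a \<le> k + t \<longrightarrow> g a k = \<zero>"
      and same: "\<forall>b. g k b = f k b" and dvg: "\<forall>a\<ge>k. \<forall>b\<ge>k. f k k divides g a b"
      using Suc.IH by (elim exE conjE)
    have sg: "supported m n g" by (rule reach_supported[OF reach f])
    then have cg: "g a b \<in> carrier R" for a b unfolding supported_def by blast
    show ?case
    proof (cases "?a < m")
      case False
      then have "g ?a k = \<zero>" using sg unfolding supported_def by simp
      then have "\<forall>a>k. a \<le> ?a \<longrightarrow> g a k = \<zero>" using clear le_Suc_eq by auto
      then show ?thesis using reach same dvg by (intro exI[of _ g] conjI)
    next
      case True
      have "f k k divides g ?a k" using dvg by simp
      then obtain x where x: "x \<in> carrier R" "g ?a k = f k k \<otimes> x"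
        unfolding factor_def by blast
      \<comment> \<open>The elementary block \<open>[[1, 0], [-x, 1]]\<close>, as the completion of
        the row \<open>(1, 0)\<close>.\<close>
      have inv: "inverse2 R \<one> \<zero> (\<ominus> x) \<one> \<one> (\<ominus> \<zero>) x \<one>"
        using inverse2_unimodular[of "\<one>" "\<zero>" "\<one>" x] x(1) by simp
      define h where "h = rowop R k ?a \<one> \<zero> (\<ominus> x) \<one> g"
      have "reach m n k f h"
        unfolding h_def by (rule reach.row[OF reach _ _ _ _ _ inv]) (use k True in auto)
      moreover have "\<forall>a>k. a \<le> ?a \<longrightarrow> h a k = \<zero>"
      proof -
        have "\<ominus> x \<otimes> f k k \<oplus> f k k \<otimes> x = \<zero>" using x(1) cf by (simp add: l_minus m_comm l_neg)
        then show ?thesis using clear same x cf unfolding h_def rowop_def by auto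
      qed
      moreover have "\<forall>b. h k b = f k b"
        using same cg cf unfolding h_def rowop_def by simp
      moreover have "\<forall>a\<ge>k. \<forall>b\<ge>k. f k k divides h a b"
        unfolding h_def using rowop_divides[OF inv cf, of k k ?a _ _ g] dvg by simp
      ultimately show ?thesis by (intro exI[of _ h] conjI)
    qed
  qed
  from this[of m] obtain g where reach: "reach m n k f g" and clear: "\<forall>a>k. a \<le> k + m \<longrightarrow> g a k = \<zero>"
      and same: "\<forall>b. g k b = f k b" and dvg: "\<forall>a\<ge>k. \<forall>b\<ge>k. f k k divides g a b"
    by (elim exE conjE)
  have "\<forall>a>k. g a k = \<zero>"
  proof (intro allI impI)
    fix a assume "k < a"
    then show "g a k = \<zero>"
      using clear reach_supported[OF reach f] unfolding supported_def by (cases "a \<le> k + m") auto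
  qed
  then show ?thesis using reach same dvg by (intro exI[of _ g] conjI)
qed

section \<open>Induction on the size of the diagonal part\<close>

text \<open>Each finished diagonal entry divides the whole block that starts at it, not just the
  next diagonal entry; in this form the property survives later operations.\<close>

definition diagonal_upto :: "nat \<Rightarrow> (nat \<Rightarrow> nat \<Rightarrow> 'a) \<Rightarrow> bool" where
  "diagonal_upto k f \<longleftrightarrow> (\<forall>a b. (a < k \<or> b < k) \<longrightarrow> a \<noteq> b \<longrightarrow> f a b = \<zero>) \<and>
    (\<forall>i<k. \<forall>a\<ge>i. \<forall>b\<ge>i. f i i divides f a b)"

lemma diagonal_upto_transpose: "diagonal_upto k f \<Longrightarrow> diagonal_upto k (\<lambda>a b. f b a)"
  unfolding diagonal_upto_def by (elim conjE, intro conjI allI impI) (metis, simp)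

text \<open>The rows before \<open>k\<close> are untouched, and in the columns before
  \<open>k\<close> the operation combines zeros.\<close>

lemma diagonal_upto_rowop:
  assumes d: "diagonal_upto k f" and f: "\<And>a b. f a b \<in> carrier R"
    and ij: "k \<le> i" "k \<le> j" and inv: "inverse2 R p q r s p' q' r' s'"
  shows "diagonal_upto k (rowop R i j p q r s f)"
  unfolding diagonal_upto_def
proof (intro conjI allI impI)
  note c = inverse2_closed[OF inv]
  fix a b assume "a < k \<or> b < k" "a \<noteq> b"
  then show "rowop R i j p q r s f a b = \<zero>"
    using d ij c unfolding diagonal_upto_def rowop_def by auto
next
  fix l a b assume l: "l < k" "l \<le> a" "l \<le> b"
  have "rowop R i j p q r s f l l = f l l" using l ij unfolding rowop_def by simp
  moreover have "f l l divides rowop R i j p q r s f a b"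
    by (rule rowop_divides[OF inv f, of l]) (use d l ij in \<open>auto simp: diagonal_upto_def\<close>)
  ultimately show "rowop R i j p q r s f l l divides rowop R i j p q r s f a b" by simp
qed

lemma reach_diagonal_upto:
  assumes "reach m n k f g" "supported m n f" "diagonal_upto k f"
  shows "diagonal_upto k g"
  using assms(1)
proof induction
  case refl
  then show ?case by (rule assms(3))
next
  case (row g i j p q r s p' q' r' s')
  then show ?case
    using diagonal_upto_rowop reach_supported[OF row.hyps(1) assms(2)] unfolding supported_def by blast
next
  case (col g i j p q r s p' q' r' s')
  \<comment> \<open>A column operation is a row operation on the transpose.\<close>
  have "diagonal_upto k (\<lambda>b a. g a b)"
    by (rule diagonal_upto_transpose[OF col.IH])
  moreover have "g a b \<in> carrier R" for a b
    using reach_supported[OF col.hyps(1) assms(2)] unfolding supported_def by blast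
  ultimately have "diagonal_upto k (rowop R i j p q r s (\<lambda>b a. g a b))"
    by (rule diagonal_upto_rowop[OF _ _ col.hyps(2,3,7)])
  then show ?case unfolding colop_def by (rule diagonal_upto_transpose)
qed

text \<open>Produce a generator of the remaining block in its corner, clear its row, then its
  column. All operations start at \<open>k\<close>, so the finished part survives.\<close>

lemma diagonal_upto_Suc:
  assumes H: "hermite_ring R" and asr: "almost_stable_range_1 R" and f: "supported m n f"
    and k: "k < m" "k < n" and d: "diagonal_upto k f"
  shows "\<exists>g. reach m n k f g \<and> diagonal_upto (Suc k) g"
proof -
  obtain g1 where r1: "reach m n k f g1" and d1: "\<forall>a\<ge>k. \<forall>b\<ge>k. g1 k k divides g1 a b"
    using submatrix_generator[OF H asr f k] by (elim exE conjE)
  note s1 = reach_supported[OF r1 f]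
  obtain g2 where r2: "reach m n k g1 g2" and z2: "\<forall>b>k. g2 k b = \<zero>"
    and d2: "\<forall>a\<ge>k. \<forall>b\<ge>k. g2 k k divides g2 a b"
    using make_row_generator[OF H s1 order_refl d1] by (elim exE conjE)
  note s2 = reach_supported[OF r2 s1]
  obtain g3 where r3: "reach m n k g2 g3" and z3: "\<forall>a>k. g3 a k = \<zero>" and same: "\<forall>b. g3 k b = g2 k b"
    and d3: "\<forall>a\<ge>k. \<forall>b\<ge>k. g2 k k divides g3 a b"
    using clear_column[OF s2 k(1) z2 d2] by (elim exE conjE)
  have r: "reach m n k f g3" by (rule reach_trans[OF r3 reach_trans[OF r2 r1]])
  have "diagonal_upto k g3" by (rule reach_diagonal_upto[OF r f d])
  \<comment> \<open>By \<open>same\<close>, the corner of \<open>g3\<close> is that of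
    \<open>g2\<close>, which divides the whole block.\<close>
  then have "diagonal_upto (Suc k) g3"
    using z2 z3 d3 same unfolding diagonal_upto_def less_Suc_eq by (metis nat_neq_iff not_less)
  then show ?thesis using r by (intro exI[of _ g3] conjI)
qed

lemma hermite_asr1_diagonal_reduction:
  assumes H: "hermite_ring R" and asr: "almost_stable_range_1 R" and A: "A \<in> mats R m n"
  shows "admits_diagonal_reduction R m n A"
proof -
  define f where "f i j = (if i < m \<and> j < n then A $$ (i, j) else \<zero>)" for i j
  have A_eq: "A = mat m n (\<lambda>(a, b). f a b)" and "f i j \<in> carrier R" for i j
    unfolding f_def using mats_fun[OF A] by auto
  then have f: "supported m n f" unfolding supported_def f_def by auto
  have "\<exists>g. reach m n 0 f g \<and> diagonal_upto k g" if "k \<le> min m n" for k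
    using that
  proof (induction k)
    case 0
    then show ?case by (intro exI[of _ f]) (auto intro: reach.refl simp: diagonal_upto_def)
  next
    case (Suc k)
    then obtain g where g: "reach m n 0 f g" "diagonal_upto k g" by auto
    obtain h where "reach m n k g h" "diagonal_upto (Suc k) h"
      using diagonal_upto_Suc[OF H asr reach_supported[OF g(1) f] _ _ g(2)] Suc.prems by auto
    then show ?case using reach_trans[OF reach_mono g(1)] by blast
  qed
  then obtain g where g: "reach m n 0 f g" and d: "diagonal_upto (min m n) g" by blast
  obtain P Q where PQ: "P \<in> GL R m" "Q \<in> GL R n"
    and eq: "mat m n (\<lambda>(a, b). g a b) = mmult R (mmult R P A) Q"
    using reach_equivalent[OF g f] unfolding A_eq[symmetric] by blast
  \<comment> \<open>For \<open>i \<noteq> j\<close> the smaller index is below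
    \<open>min m n\<close>, within the diagonal part.\<close>
  have "\<forall>i<m. \<forall>j<n. i \<noteq> j \<longrightarrow> mat m n (\<lambda>(a, b). g a b) $$ (i, j) = \<zero>"
    using d unfolding diagonal_upto_def by (auto simp: min_less_iff_disj) (metis nat_neq_iff order.strict_trans)
  moreover have "\<forall>i. i + 1 < min m n \<longrightarrow>
      mat m n (\<lambda>(a, b). g a b) $$ (i, i) divides mat m n (\<lambda>(a, b). g a b) $$ (i + 1, i + 1)"
    using d unfolding diagonal_upto_def by auto
  ultimately show ?thesis
    unfolding admits_diagonal_reduction_def using PQ eq by blast
qed

end

theorem corollary1p22:
  fixes R :: "('a, 'b) ring_scheme"
  assumes "cring R"
    and "almost_stable_range_1 R"
  shows "SE2_triangle_ring R \<and> (hermite_ring R \<longrightarrow> elementary_divisor_ring R)"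
  unfolding elementary_divisor_ring_def
  by (intro conjI impI allI ballI cring.asr1_SE2_triangle[OF assms]
      cring.hermite_asr1_diagonal_reduction[OF assms(1) _ assms(2)])

end
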